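(* Let $p\le q$ be positive integers, let $M\in\mathbb{R}^{m\times n}$ have $\operatorname{rank}(M)\ge p+1$, let $\widehat{M}$ be a maximal volume pseudo skeleton approximation of $M$ with parameters $p\le q$, and let $r=\operatorname{rank}(\widehat{M})$. Then $$\left\|\widehat{M}-M\right\|_C\le\sqrt{\frac{\zeta_r(M^TM)}{1-r/(q+1)}}\;\sigma_{r+1}(M).$$
   Context: Chebyshev norm: $\|X\|_C=\max_{i,j}|X_{i,j}|$. Singular values are ordered decreasingly, $\sigma_1(M)\ge\sigma_2(M)\ge\cdots$. Pseudo skeleton approximation: let $M\in\mathbb{R}^{m\times n}$ and let $P_1\in\mathbb{R}^{m\times m}$, $P_2\in\mathbb{R}^{n\times n}$ be permutation matrices with $P_1MP_2^T=\begin{bmatrix}A&B\\C&D\end{bmatrix}$, $A\in\mathbb{R}^{p\times q}$ ($p\le m$, $q\le n$). With $A^+$ the Moore-Penrose inverse of $A$, the matrix $\widehat{M}=P_1^T\begin{bmatrix}A\\C\end{bmatrix}A^+\begin{bmatrix}A&B\end{bmatrix}P_2$ is called a pseudo skeleton approximation of $M$ with parameters $p,q$. It is called a maximal volume approximation if $P_1,P_2$ are chosen (among all pairs of permutations) so that $\operatorname{rank}(A)=r$ is maximal and, subject to this, the $r$-volume $\operatorname{vol}_r(A)=\sigma_1(A)\cdots\sigma_r(A)$ is maximal. In that case $\operatorname{rank}(\widehat{M})=\operatorname{rank}(A)=r\le p$. $\zeta_r(M^TM)=H(\sigma_1^2,\ldots,\sigma_{r+1}^2)/\sigma_{r+1}^2$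 with $\sigma_k=\sigma_k(M)$, where $H(x_1,\ldots,x_{r+1})=\dfrac{r+1}{x_1^{-1}+\cdots+x_{r+1}^{-1}}$ is the harmonic mean. *)

theory Defs
  imports
    Complex_Main
    "HOL-Combinatorics.Permutations"
    "Jordan_Normal_Form.Char_Poly"
    "Jordan_Normal_Form.DL_Rank"
begin

abbreviation mat_rank :: "real mat \<Rightarrow> nat" where
  "mat_rank A \<equiv> vec_space.rank (dim_row A) A"

text \<open>Meaningful only for matrices with at least one row and one column.\<close>
definition chebyshev_norm :: "real mat \<Rightarrow> real" where
  "chebyshev_norm X = Max {\<bar>X $$ (i, j)\<bar> | i j. i < dim_row X \<and> j < dim_col X}"

text \<open>The square roots of all \<open>dim_col M\<close> eigenvalues of \<open>M\<^sup>T M\<close>, with multiplicity, in decreasing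
  order. If \<open>M\<close> has fewer rows than columns, this pads the usual list of length
  \<open>min (dim_row M) (dim_col M)\<close> with zeros.\<close>
definition singular_values :: "real mat \<Rightarrow> real list" where
  "singular_values M =
     rev (sorted_list_of_multiset (image_mset sqrt (proots (char_poly (transpose_mat M * M)))))"

text \<open>Indexing starts at 1.\<close>
definition singular_value :: "real mat \<Rightarrow> nat \<Rightarrow> real" where
  "singular_value M k =
     (if 1 \<le> k \<and> k \<le> length (singular_values M) then singular_values M ! (k - 1) else 0)"

definition rvol :: "nat \<Rightarrow> real mat \<Rightarrow> real" where
  "rvol r A = (\<Prod>k = 1..r. singular_value A k)"

definition is_pinv :: "real mat \<Rightarrow> real mat \<Rightarrow> bool" where
  "is_pinv A X \<longleftrightarrow>
     X \<in> carrier_mat (dim_col A) (dim_row A) \<and>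
     A * X * A = A \<and> X * A * X = X \<and>
     transpose_mat (A * X) = A * X \<and> transpose_mat (X * A) = X * A"

text \<open>The four Penrose equations have exactly one solution for every real matrix; uniqueness is
  proved below.\<close>
definition pinv :: "real mat \<Rightarrow> real mat" where
  "pinv A = (THE X. is_pinv A X)"

lemma is_pinv_unique:
  assumes "is_pinv A X" "is_pinv A Y"
  shows "X = Y"
proof -
  define m n where "m = dim_row A" and "n = dim_col A"
  have A [simp]: "A \<in> carrier_mat m n" and X [simp]: "X \<in> carrier_mat n m"
    and Y [simp]: "Y \<in> carrier_mat n m"
    using assms by (auto simp: is_pinv_def m_def n_def)
  note X' = assms(1)[unfolded is_pinv_def] and Y' = assms(2)[unfolded is_pinv_def]
  have AX [simp]: "A * X \<in> carrier_mat m m" and AY [simp]: "A * Y \<in> carrier_mat m m"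
    and XA [simp]: "X * A \<in> carrier_mat n n" and YA [simp]: "Y * A \<in> carrier_mat n n"
    using A X Y mult_carrier_mat by blast+
  have "A * X = (A * Y) * (A * X)"
    using Y' assoc_mult_mat[OF AY A X] by metis
  also have "\<dots> = transpose_mat ((A * X) * (A * Y))"
    using X' Y' transpose_mult[OF AX AY] by metis
  also have "\<dots> = A * Y"
    using X' Y' assoc_mult_mat[OF AX A Y] by metis
  finally have 1: "A * X = A * Y" .
  have "X * A = (X * A) * (Y * A)"
    using Y' assoc_mult_mat[OF X A YA] assoc_mult_mat[OF A Y A] by metis
  also have "\<dots> = transpose_mat ((Y * A) * (X * A))"
    using X' Y' transpose_mult[OF YA XA] by metis
  also have "\<dots> = Y * A"
    using X' Y' assoc_mult_mat[OF Y A XA] assoc_mult_mat[OF A X A] by metis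
  finally have 2: "X * A = Y * A" .
  have "X = X * A * X" using X' by simp
  also have "\<dots> = X * (A * Y)"
    using assoc_mult_mat[OF X A X] 1 by metis
  also have "\<dots> = Y * A * Y"
    using assoc_mult_mat[OF X A Y] 2 by metis
  finally show ?thesis using Y' by simp
qed

definition permutation_mat :: "nat \<Rightarrow> real mat \<Rightarrow> bool" where
  "permutation_mat n P \<longleftrightarrow>
     (\<exists>\<pi>. \<pi> permutes {..<n} \<and> P = mat n n (\<lambda>(i, j). if j = \<pi> i then 1 else 0))"

definition append_cols :: "'a :: zero mat \<Rightarrow> 'a mat \<Rightarrow> 'a mat" (infixr \<open>@\<^sub>c\<close> 65) where
  "A @\<^sub>c B = four_block_mat A B (0\<^sub>m 0 (dim_col A)) (0\<^sub>m 0 (dim_col B))"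

definition perm_blocks ::
  "real mat \<Rightarrow> nat \<Rightarrow> nat \<Rightarrow> real mat \<Rightarrow> real mat \<Rightarrow> real mat \<times> real mat \<times> real mat \<times> real mat"
where
  "perm_blocks M p q P1 P2 = split_block (P1 * M * transpose_mat P2) p q"

definition leading_block :: "real mat \<Rightarrow> nat \<Rightarrow> nat \<Rightarrow> real mat \<Rightarrow> real mat \<Rightarrow> real mat" where
  "leading_block M p q P1 P2 = (case perm_blocks M p q P1 P2 of (A, B, C, D) \<Rightarrow> A)"

definition pseudo_skeleton :: "real mat \<Rightarrow> nat \<Rightarrow> nat \<Rightarrow> real mat \<Rightarrow> real mat \<Rightarrow> real mat" where
  "pseudo_skeleton M p q P1 P2 =
     (case perm_blocks M p q P1 P2 of (A, B, C, D) \<Rightarrow>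
        transpose_mat P1 * (A @\<^sub>r C) * pinv A * (A @\<^sub>c B) * P2)"

definition max_vol_perms :: "real mat \<Rightarrow> nat \<Rightarrow> nat \<Rightarrow> real mat \<Rightarrow> real mat \<Rightarrow> bool" where
  "max_vol_perms M p q P1 P2 \<longleftrightarrow>
     permutation_mat (dim_row M) P1 \<and> permutation_mat (dim_col M) P2 \<and>
     (\<forall>Q1 Q2. permutation_mat (dim_row M) Q1 \<and> permutation_mat (dim_col M) Q2 \<longrightarrow>
        (let A = leading_block M p q P1 P2; A' = leading_block M p q Q1 Q2 in
           mat_rank A' \<le> mat_rank A \<and>
           (mat_rank A' = mat_rank A \<longrightarrow> rvol (mat_rank A) A' \<le> rvol (mat_rank A) A)))"

definition max_vol_pseudo_skeleton :: "real mat \<Rightarrow> nat \<Rightarrow> nat \<Rightarrow> real mat \<Rightarrow> bool" where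
  "max_vol_pseudo_skeleton M p q Mhat \<longleftrightarrow>
     (\<exists>P1 P2. max_vol_perms M p q P1 P2 \<and> Mhat = pseudo_skeleton M p q P1 P2)"

definition harmonic_mean :: "nat \<Rightarrow> (nat \<Rightarrow> real) \<Rightarrow> real" where
  "harmonic_mean N x = real N / (\<Sum>k = 1..N. inverse (x k))"

text \<open>This is \<open>\<zeta>\<^sub>r(M\<^sup>T M)\<close>, as a function of \<open>M\<close> rather than of the Gram matrix.\<close>
definition zeta_gram :: "nat \<Rightarrow> real mat \<Rightarrow> real" where
  "zeta_gram r M =
     harmonic_mean (r + 1) (\<lambda>k. (singular_value M k)\<^sup>2) / (singular_value M (r + 1))\<^sup>2"

end

(*
  Since rank M > p and p \<le> q, a leading block A of maximal rank has full row rank p, so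
  vol(A)^2 = det(A A^T) and A^+ = A^T (A A^T)^-1. In the permuted coordinates the error in row i is,
  up to sign, the residual of row i of M after subtracting the combination of the first p rows that
  is the least squares fit on the first q columns.

  Let Z be A bordered by row i and (if needed) the column j of the error entry e, and let G = Z Z^T.
  Replacing the last row of Z by its residual gives det G \<ge> vol(A)^2 e^2. Deleting columns of a p-rowed matrix W
  satisfies sum_j det(W_j W_j^T) = (#columns - p) det(W W^T). Summing this over the p-rowed
  submatrices of Z and using that all p x q submatrices have volume at most vol(A) bounds
  tr(G^-1) det G by (p+1)(q+1)/(q+1-p) vol(A)^2. Finally tr(G^-1) is at least the sum of
  sigma_k(M)^-2 for k \<le> p+1, since Z is a submatrix of M; this is where the harmonic mean arises.
*)
theory Submission
  imports Defs "Jordan_Normal_Form.Schur_Decomposition"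
begin

section \<open>Spectral theorem for real symmetric matrices\<close>

text \<open>tr(G^-1) det G is the sum of the p+1 principal minors of G of size p, each the squared
  volume of p rows of Z; so maximality controls this product while the singular values control the
  trace. An obstacle is that the residual is orthogonal to the rows of A only on the q columns of A.
  On the bordered column set a second projection is needed, and its loss is exactly the factor by
  which the Gram determinant drops when the added column is removed again. Hence det G is vol(A)^2
  e^2 plus a nonnegative term, with no constant lost. With S the sum of sigma_k^-2 for k <= p+1, the
  estimates give e^2 <= (p+1)(q+1) / ((q+1-p) S). This is the claim, since zeta sigma_{p+1}^2 =
  (p+1)/S and 1 - p/(q+1) = (q+1-p)/(q+1). The trace is compared with S as a whole, through weights
  in [0,1] of total p+1 on the eigenvalues of M^T M, instead of interlacing singular values one at a
  time.\<close>

lemma mult_mat_index: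
  assumes "A \<in> carrier_mat m n" "B \<in> carrier_mat n l" "i < m" "j < l"
  shows "(A * B) $$ (i, j) = (\<Sum>k<n. A $$ (i, k) * B $$ (k, j))"
  using assms by (auto simp: scalar_prod_def atLeast0LessThan intro!: sum.cong)

text \<open>Over the complex numbers the polynomial splits. For an eigenvector with eigenvalue a,
  the Hermitian form \<open>S\<close> equals \<open>a * N\<close>; both \<open>S\<close> and
  \<open>N\<close> are self-conjugate because the matrix is real and symmetric, and \<open>N\<close>
  is nonzero, so a is real. The factorization descends because the embedding of real into complex
  polynomials is injective.\<close>

lemma symmetric_char_poly_splits:
  fixes A :: "real mat"
  assumes A: "A \<in> carrier_mat n n" and sym: "transpose_mat A = A"
  shows "\<exists>es. char_poly A = (\<Prod>e\<leftarrow>es. [:- e, 1:])"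
proof -
  interpret rp: map_poly_inj_idom_hom complex_of_real ..
  define C where "C = map_mat complex_of_real A"
  have C: "C \<in> carrier_mat n n" using A by (simp add: C_def)
  have cC: "char_poly C = map_poly complex_of_real (char_poly A)"
    unfolding C_def by (rule of_real_hom.char_poly_hom[OF A])
  obtain as where as: "char_poly C = (\<Prod>a\<leftarrow>as. [:- a, 1:])"
    using char_poly_factorized[OF C] by blast
  have real: "a = complex_of_real (Re a)" if a: "a \<in> set as" for a
  proof -
    have "poly (char_poly C) a = 0"
      unfolding as using a by (induction as) auto
    then have "eigenvalue C a" by (simp add: eigenvalue_root_char_poly[OF C])
    then obtain v where v: "v \<in> carrier_vec n" "v \<noteq> 0\<^sub>v n" and ev: "C *\<^sub>v v = a \<cdot>\<^sub>v v"
      using C unfolding eigenvalue_def eigenvector_def by auto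
    have evi: "(\<Sum>j<n. C $$ (i, j) * v $ j) = a * v $ i" if "i < n" for i
    proof -
      have "(C *\<^sub>v v) $ i = (\<Sum>j<n. C $$ (i, j) * v $ j)"
        using that C v(1) by (auto simp: scalar_prod_def atLeast0LessThan intro!: sum.cong)
      with ev that v(1) show ?thesis by simp
    qed
    have Csym: "C $$ (i, j) = C $$ (j, i)" if "i < n" "j < n" for i j
      using arg_cong[OF sym, of "\<lambda>X. X $$ (i, j)"] that A by (simp add: C_def)
    have Ccnj: "cnj (C $$ (i, j)) = C $$ (i, j)" if "i < n" "j < n" for i j
      using that A by (simp add: C_def)
    define S where "S = (\<Sum>i<n. \<Sum>j<n. cnj (v $ i) * C $$ (i, j) * v $ j)"
    define N where "N = (\<Sum>i<n. cnj (v $ i) * v $ i)"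
    have S: "S = a * N"
    proof -
      have "S = (\<Sum>i<n. cnj (v $ i) * (a * v $ i))"
        unfolding S_def by (simp add: mult.assoc evi flip: sum_distrib_left)
      then show ?thesis unfolding N_def by (simp add: sum_distrib_left mult_ac)
    qed
    have "cnj S = S"
    proof -
      have "cnj S = (\<Sum>i<n. \<Sum>j<n. v $ i * C $$ (j, i) * cnj (v $ j))"
        unfolding S_def by (auto intro!: sum.cong simp: Ccnj Csym)
      also have "\<dots> = S"
        unfolding S_def by (subst sum.swap) (auto intro!: sum.cong simp: mult_ac)
      finally show ?thesis .
    qed
    moreover have "cnj N = N" unfolding N_def by (auto simp: mult_ac)
    moreover have "N \<noteq> 0"
    proof -
      obtain i where i: "i < n" "v $ i \<noteq> 0" using v by (metis eq_vecI carrier_vecD index_zero_vec)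
      have "N = complex_of_real (\<Sum>i<n. (cmod (v $ i))\<^sup>2)"
        unfolding N_def of_real_sum
        by (intro sum.cong refl) (metis complex_norm_square mult.commute)
      moreover have "(\<Sum>i<n. (cmod (v $ i))\<^sup>2) > 0"
        by (rule sum_pos2[of _ i]) (use i in auto)
      ultimately show ?thesis by (metis of_real_eq_0_iff less_irrefl)
    qed
    ultimately have "cnj a = a" using S by simp
    then show ?thesis by (metis complex_cnj_cancel_iff complex_is_Real_iff Reals_cnj_iff of_real_Re)
  qed
  have "map_poly complex_of_real (char_poly A)
      = map_poly complex_of_real (\<Prod>e\<leftarrow>map Re as. [:- e, 1:])"
  proof -
    have "(\<Prod>a\<leftarrow>as. [:- a, 1:]) = map_poly complex_of_real (\<Prod>e\<leftarrow>map Re as. [:- e, 1:])"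
      using real
    proof (induction as)
      case (Cons a as)
      have "[:- a, 1:] = map_poly complex_of_real [:- Re a, 1:]"
        using Cons.prems[of a] by (simp add: map_poly_pCons)
      moreover have "(\<Prod>a\<leftarrow>as. [:- a, 1:]) = map_poly complex_of_real (\<Prod>e\<leftarrow>map Re as. [:- e, 1:])"
        using Cons by simp
      ultimately show ?case
        by (simp only: list.map prod_list.Cons rp.hom_mult o_def)
    qed simp
    then show ?thesis using as cC by simp
  qed
  then have "char_poly A = (\<Prod>e\<leftarrow>map Re as. [:- e, 1:])"
    by (simp only: rp.eq_iff)
  then show ?thesis by blast
qed

definition diag_list :: "real list \<Rightarrow> real mat" where
  "diag_list es = mat (length es) (length es) (\<lambda>(i, j). if i = j then es ! i else 0)"

text \<open>Gram-Schmidt on a basis that starts with an eigenvector keeps that vector in front. Its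
  output is orthogonal but not normalized, so each vector is divided by its length
  \<open>c j\<close>.\<close>

lemma orthogonal_mat_with_eigenvector:
  fixes A :: "real mat"
  assumes A: "A \<in> carrier_mat n n" and ev: "eigenvalue A e"
  obtains W where "W \<in> carrier_mat n n" "transpose_mat W * W = 1\<^sub>m n"
    "\<And>i. i < n \<Longrightarrow> (A * W) $$ (i, 0) = e * W $$ (i, 0)" "0 < n"
proof -
  obtain v where v: "v \<in> carrier_vec n" "v \<noteq> 0\<^sub>v n" and Av: "A *\<^sub>v v = e \<cdot>\<^sub>v v"
    using ev A unfolding eigenvalue_def eigenvector_def by auto
  have n: "0 < n" using v by (cases n) auto
  interpret cof_vec_space n "TYPE(real)" .
  define b where "b = basis_completion v"
  define ws where "ws = gram_schmidt n b"
  note bc = basis_completion[OF v, folded b_def]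
  have hdb: "hd b = v" and lenb: "length b = n" using bc by auto
  then obtain vs where bv: "b = v # vs" using n by (cases b) auto
  have orth: "corthogonal ws" and wsn: "set ws \<subseteq> carrier_vec n" and lenw: "length ws = n"
    using gram_schmidt_result[OF bc(2,4,5) ws_def] lenb by auto
  have hdw: "ws ! 0 = v"
    using gram_schmidt_hd[OF v(1), of vs] lenw n
    by (metis bv ws_def hd_conv_nth length_greater_0_conv)
  have wsc: "ws ! i \<in> carrier_vec n" if "i < n" for i
    using wsn lenw that nth_mem by blast
  have ip: "ws ! i \<bullet> ws ! j = (\<Sum>k<n. ws ! i $ k * ws ! j $ k)" if "j < n" for i j
    using wsc[OF that] by (auto simp: scalar_prod_def atLeast0LessThan)
  have ip0: "ws ! i \<bullet> ws ! j = 0 \<longleftrightarrow> i \<noteq> j" if "i < n" "j < n" for i j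
    using corthogonalD[OF orth, of i j] that lenw by simp
  define c where "c j = sqrt (ws ! j \<bullet> ws ! j)" for j
  have c2: "c j * c j = ws ! j \<bullet> ws ! j" and c0: "c j \<noteq> 0" if "j < n" for j
  proof -
    have "ws ! j \<bullet> ws ! j \<ge> 0" unfolding ip[OF that] by (intro sum_nonneg) auto
    moreover have "ws ! j \<bullet> ws ! j \<noteq> 0" using ip0[of j j] that by simp
    ultimately show "c j * c j = ws ! j \<bullet> ws ! j" "c j \<noteq> 0" by (auto simp: c_def)
  qed
  define W where "W = mat n n (\<lambda>(i, j). ws ! j $ i / c j)"
  have W: "W \<in> carrier_mat n n" by (simp add: W_def)
  have "transpose_mat W * W = 1\<^sub>m n"
  proof (rule eq_matI)
    fix i j assume "i < dim_row (1\<^sub>m n :: real mat)" "j < dim_col (1\<^sub>m n :: real mat)"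
    then have ij: "i < n" "j < n" by auto
    have "(transpose_mat W * W) $$ (i, j) = (\<Sum>k<n. transpose_mat W $$ (i, k) * W $$ (k, j))"
      by (rule mult_mat_index[of _ n n]) (use W ij in auto)
    also have "\<dots> = (\<Sum>k<n. ws ! i $ k * ws ! j $ k) / (c i * c j)"
      unfolding sum_divide_distrib using ij by (intro sum.cong) (auto simp: W_def)
    also have "\<dots> = (ws ! i \<bullet> ws ! j) / (c i * c j)" using ip ij by simp
    also have "\<dots> = 1\<^sub>m n $$ (i, j)"
      using ij ip0[of i j] c2[of i] c0[of i] by (auto simp: simp flip: c2)
    finally show "(transpose_mat W * W) $$ (i, j) = 1\<^sub>m n $$ (i, j)" .
  qed (use W in auto)
  moreover have "(A * W) $$ (i, 0) = e * W $$ (i, 0)" if i: "i < n" for i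
  proof -
    have "(A * W) $$ (i, 0) = (\<Sum>k<n. A $$ (i, k) * v $ k) / c 0"
      unfolding mult_mat_index[OF A W i n] sum_divide_distrib using n hdw
      by (intro sum.cong) (auto simp: W_def)
    also have "(\<Sum>k<n. A $$ (i, k) * v $ k) = (A *\<^sub>v v) $ i"
      using i A v(1) by (auto simp: scalar_prod_def atLeast0LessThan intro!: sum.cong)
    also have "\<dots> = e * v $ i" unfolding Av using i v(1) by simp
    finally show ?thesis using i n hdw by (simp add: W_def)
  qed
  ultimately show ?thesis using that W n by blast
qed

lemma orthogonal_transpose_right_inverse:
  fixes W :: "real mat"
  assumes W: "W \<in> carrier_mat n n" "transpose_mat W * W = 1\<^sub>m n"
  shows "W * transpose_mat W = 1\<^sub>m n"
  by (rule mat_mult_left_right_inverse[OF _ W(1) W(2)]) (use W in auto)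

text \<open>Deflation: conjugating by \<open>W\<close> leaves e in the corner and zeros in the rest
  of column 0, by symmetry also of row 0; cancelling one linear factor gives the smaller block the
  roots \<open>es\<close>. The diagonal follows the order of the given list, so a sorted list yields
  an eigenbasis sorted alike.\<close>

lemma symmetric_diagonalization:
  fixes A :: "real mat"
  assumes "A \<in> carrier_mat n n" "transpose_mat A = A" "char_poly A = (\<Prod>e\<leftarrow>es. [:- e, 1:])"
  shows "length es = n \<and> (\<exists>U \<in> carrier_mat n n.
    transpose_mat U * U = 1\<^sub>m n \<and> transpose_mat U * A * U = diag_list es)"
  using assms
proof (induction es arbitrary: n A)
  case Nil
  then have n: "n = 0" using degree_monic_char_poly[of A n] by auto
  show ?case
    using Nil(1) unfolding n
    by (auto intro!: bexI[of _ "0\<^sub>m 0 0"] eq_matI simp: diag_list_def)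
next
  case (Cons e es)
  note A = Cons.prems(1) and sym = Cons.prems(2)
  have "eigenvalue A e" unfolding eigenvalue_root_char_poly[OF A] Cons.prems(3) by simp
  then obtain W where W: "W \<in> carrier_mat n n" and WW: "transpose_mat W * W = 1\<^sub>m n"
    and AW: "\<And>i. i < n \<Longrightarrow> (A * W) $$ (i, 0) = e * W $$ (i, 0)" and n0: "0 < n"
    by (metis orthogonal_mat_with_eigenvector[OF A])
  obtain k where n: "n = Suc k" using n0 by (cases n) auto
  have Wt: "transpose_mat W \<in> carrier_mat n n" using W by simp
  note WW' = orthogonal_transpose_right_inverse[OF W WW]
  define B where "B = transpose_mat W * A * W"
  have B: "B \<in> carrier_mat n n" using A W by (auto simp: B_def)
  have Bsym: "transpose_mat B = B"
    unfolding B_def using A W sym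
    by (simp add: transpose_mult[of _ n n _ n] assoc_mult_mat[of _ n n _ n _ n])
  have B0: "B $$ (i, 0) = (if i = 0 then e else 0)" if i: "i < n" for i
  proof -
    have "B $$ (i, 0) = (transpose_mat W * (A * W)) $$ (i, 0)"
      unfolding B_def using A W by (simp add: assoc_mult_mat[of _ n n _ n _ n])
    also have "\<dots> = (\<Sum>k<n. transpose_mat W $$ (i, k) * (A * W) $$ (k, 0))"
      by (rule mult_mat_index[of _ n n]) (use W A i n in auto)
    also have "\<dots> = e * (\<Sum>k<n. transpose_mat W $$ (i, k) * W $$ (k, 0))"
      unfolding sum_distrib_left by (intro sum.cong) (auto simp: AW)
    also have "(\<Sum>k<n. transpose_mat W $$ (i, k) * W $$ (k, 0)) = (transpose_mat W * W) $$ (i, 0)"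
      by (rule mult_mat_index[OF Wt W i n0, symmetric])
    finally show ?thesis using i n0 unfolding WW by simp
  qed
  have B0': "B $$ (0, i) = (if i = 0 then e else 0)" if i: "i < n" for i
    using arg_cong[OF Bsym, of "\<lambda>X. X $$ (i, 0)"] B0[OF i] B i n0 by simp
  define C where "C = mat k k (\<lambda>(i, j). B $$ (Suc i, Suc j))"
  have C: "C \<in> carrier_mat k k" by (simp add: C_def)
  define E where "E = mat 1 1 (\<lambda>_. e)"
  have E: "E \<in> carrier_mat 1 1" by (simp add: E_def)
  have BC: "B = four_block_mat E (0\<^sub>m 1 k) (0\<^sub>m k 1) C"
    using B B0 B0' by (intro eq_matI) (auto simp: n E_def C_def)
  have Csym: "transpose_mat C = C"
  proof (rule eq_matI)
    fix i j assume "i < dim_row C" "j < dim_col C"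
    then show "transpose_mat C $$ (i, j) = C $$ (i, j)"
      using arg_cong[OF Bsym, of "\<lambda>X. X $$ (Suc i, Suc j)"] B by (simp add: C_def n)
  qed (use C in auto)
  have "similar_mat B A"
    unfolding similar_mat_def
    by (intro exI, rule similar_mat_witI[of "transpose_mat W" W n]) (use W A B WW WW' in \<open>auto simp: B_def\<close>)
  then have "char_poly B = [:- e, 1:] * (\<Prod>e\<leftarrow>es. [:- e, 1:])"
    using char_poly_similar Cons.prems(3) by fastforce
  moreover have "char_poly B = char_poly E * char_poly C"
    unfolding BC by (rule char_poly_four_block_zeros_col[OF E _ C]) auto
  moreover have "char_poly E = [:- e, 1:]"
    by (simp add: E_def char_poly_defs det_single)
  ultimately have "char_poly C = (\<Prod>e\<leftarrow>es. [:- e, 1:])"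
    by (metis mult_cancel_left pCons_eq_0_iff zero_neq_one)
  from Cons.IH[OF C Csym this] obtain V where len: "length es = k" and V: "V \<in> carrier_mat k k"
    and VV: "transpose_mat V * V = 1\<^sub>m k" and VCV: "transpose_mat V * C * V = diag_list es"
    by blast
  define F where "F = four_block_mat (1\<^sub>m 1) (0\<^sub>m 1 k) (0\<^sub>m k 1) V"
  have F: "F \<in> carrier_mat n n" unfolding F_def n
    using four_block_carrier_mat[OF one_carrier_mat[of 1] V] by simp
  have Ft: "transpose_mat F = four_block_mat (1\<^sub>m 1) (0\<^sub>m 1 k) (0\<^sub>m k 1) (transpose_mat V)"
    unfolding F_def by (subst transpose_four_block_mat[of _ 1 1 _ k _ k]) (use V in auto)
  have FF: "transpose_mat F * F = 1\<^sub>m n"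
  proof -
    have "transpose_mat F * F = four_block_mat (1\<^sub>m 1) (0\<^sub>m 1 k) (0\<^sub>m k 1) (1\<^sub>m k)"
      unfolding Ft unfolding F_def
      by (subst mult_four_block_mat[of _ 1 1 _ k _ k _ _ 1 _ k]) (use V VV in auto)
    then show ?thesis by (simp add: n)
  qed
  have FBF: "transpose_mat F * B * F = diag_list (e # es)"
  proof -
    have 1: "transpose_mat F * B = four_block_mat E (0\<^sub>m 1 k) (0\<^sub>m k 1) (transpose_mat V * C)"
      unfolding Ft unfolding BC
      by (subst mult_four_block_mat[of _ 1 1 _ k _ k _ _ 1 _ k]) (use V C E in auto)
    have "transpose_mat F * B * F = four_block_mat E (0\<^sub>m 1 k) (0\<^sub>m k 1) (diag_list es)"
      unfolding 1 unfolding F_def VCV[symmetric]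
      by (subst mult_four_block_mat[of _ 1 1 _ k _ k _ _ 1 _ k]) (use V C E in auto)
    also have "\<dots> = diag_list (e # es)"
      by (intro eq_matI) (auto simp: diag_list_def E_def len nth_Cons' )
    finally show ?thesis .
  qed
  define U where "U = W * F"
  have U: "U \<in> carrier_mat n n" using W F by (simp add: U_def)
  have Ut: "transpose_mat U = transpose_mat F * transpose_mat W"
    unfolding U_def by (rule transpose_mult[OF W F])
  have "transpose_mat U * U = transpose_mat F * (transpose_mat W * W) * F"
    unfolding Ut unfolding U_def using W F by (simp add: assoc_mult_mat[of _ n n _ n _ n])
  then have "transpose_mat U * U = 1\<^sub>m n" using F FF by (simp add: WW)
  moreover have "transpose_mat U * A * U = transpose_mat F * B * F"
    unfolding Ut unfolding U_def B_def using W F A by (simp add: assoc_mult_mat[of _ n n _ n _ n])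
  ultimately show ?case using U FBF len n by (auto intro!: bexI[of _ U])
qed

section \<open>Singular values and volume\<close>

lemma diag_list_carrier [simp]: "diag_list es \<in> carrier_mat (length es) (length es)"
  by (simp add: diag_list_def)

lemma det_diag_list: "det (diag_list es) = prod_list es"
proof -
  have "diag_mat (diag_list es) = es"
    by (auto simp: diag_mat_def diag_list_def intro!: nth_equalityI)
  moreover have "upper_triangular (diag_list es)"
    by (auto simp: diag_list_def)
  ultimately show ?thesis by (metis det_upper_triangular diag_list_carrier)
qed

lemma det_orthogonal_conjugation:
  fixes A :: "real mat"
  assumes U: "U \<in> carrier_mat n n" "transpose_mat U * U = 1\<^sub>m n" and A: "A \<in> carrier_mat n n"
  shows "det (transpose_mat U * A * U) = det A"
proof -
  have "det (transpose_mat U) * det U = 1"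
    using det_mult[of "transpose_mat U" n U] U by simp
  moreover have "det (transpose_mat U * A * U) = det (transpose_mat U) * det A * det U"
    using U A by (simp add: det_mult[of _ n])
  ultimately show ?thesis by (metis mult.assoc mult.commute mult_1)
qed

lemma proots_linear_factors:
  fixes es :: "'a :: idom list"
  shows "proots (\<Prod>e\<leftarrow>es. [:- e, 1:]) = mset es"
proof (induction es)
  case (Cons e es)
  have "(\<Prod>e\<leftarrow>es. [:- e, 1:]) \<noteq> 0" by (auto simp: prod_list_zero_iff)
  then show ?case using Cons by (simp add: proots_mult del: mult_pCons_left)
qed simp

lemma prod_list_map_mset_cong:
  fixes f :: "'b \<Rightarrow> 'a :: comm_monoid_mult"
  assumes "mset xs = mset ys"
  shows "(\<Prod>x\<leftarrow>xs. f x) = (\<Prod>x\<leftarrow>ys. f x)"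
  using assms by (metis mset_map prod_mset_prod_list)

text \<open>Replaces the root multiset behind \<open>singular_values\<close> by a decreasing
  eigenvalue list with an orthonormal eigenbasis in the same order. Eigenvalues are nonnegative
  because the diagonal entries of (M U)^T (M U) are sums of squares.\<close>

lemma singular_values_spectral:
  assumes M: "M \<in> carrier_mat m n"
  obtains es U where "length es = n" "sorted (rev es)" "\<forall>e\<in>set es. 0 \<le> e"
    "char_poly (transpose_mat M * M) = (\<Prod>e\<leftarrow>es. [:- e, 1:])"
    "singular_values M = map sqrt es"
    "U \<in> carrier_mat n n" "transpose_mat U * U = 1\<^sub>m n"
    "transpose_mat U * (transpose_mat M * M) * U = diag_list es"
proof -
  define G where "G = transpose_mat M * M"
  have G: "G \<in> carrier_mat n n" using M by (simp add: G_def)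
  have Gsym: "transpose_mat G = G"
    unfolding G_def using M by (simp add: transpose_mult[of _ n m _ n])
  obtain es0 where es0: "char_poly G = (\<Prod>e\<leftarrow>es0. [:- e, 1:])"
    using symmetric_char_poly_splits[OF G Gsym] by blast
  define es where "es = rev (sort es0)"
  have es: "char_poly G = (\<Prod>e\<leftarrow>es. [:- e, 1:])"
    unfolding es0 by (rule prod_list_map_mset_cong) (simp add: es_def)
  have sorted: "sorted (rev es)" by (simp add: es_def)
  obtain U where len: "length es = n" and U: "U \<in> carrier_mat n n" "transpose_mat U * U = 1\<^sub>m n"
    and UGU: "transpose_mat U * G * U = diag_list es"
    using symmetric_diagonalization[OF G Gsym es] by blast
  have nonneg: "0 \<le> e" if e: "e \<in> set es" for e
  proof -
    obtain i where i: "i < n" "e = es ! i" using e len by (auto simp: in_set_conv_nth)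
    have "transpose_mat U * G * U = transpose_mat U * transpose_mat M * M * U"
      unfolding G_def using M U(1) assoc_mult_mat[of "transpose_mat U" n n "transpose_mat M" m M n] by simp
    also have "\<dots> = transpose_mat U * transpose_mat M * (M * U)"
      by (rule assoc_mult_mat[of _ n m _ n _ n]) (use M U(1) in auto)
    also have "transpose_mat U * transpose_mat M = transpose_mat (M * U)"
      by (rule transpose_mult[OF M U(1), symmetric])
    finally have "transpose_mat U * G * U = transpose_mat (M * U) * (M * U)" .
    then have "transpose_mat (M * U) * (M * U) = diag_list es" by (simp add: UGU)
    then have "e = (transpose_mat (M * U) * (M * U)) $$ (i, i)"
      using i len by (simp add: diag_list_def)
    also have "\<dots> = (\<Sum>k<m. transpose_mat (M * U) $$ (i, k) * (M * U) $$ (k, i))"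
      by (rule mult_mat_index[of _ n m]) (use M U i in auto)
    also have "\<dots> = (\<Sum>k<m. ((M * U) $$ (k, i))\<^sup>2)"
      using M U i by (intro sum.cong) (auto simp: power2_eq_square)
    finally show ?thesis by (simp add: sum_nonneg)
  qed
  have "singular_values M = rev (sort (map sqrt es))"
    unfolding singular_values_def G_def[symmetric] es proots_linear_factors
    by (metis mset_map sorted_list_of_multiset_mset)
  also have "sort (map sqrt es) = map sqrt (rev es)"
  proof (rule properties_for_sort)
    show "sorted (map sqrt (rev es))"
      unfolding sorted_wrt_map by (rule sorted_wrt_mono_rel[OF _ sorted]) simp
  qed (simp flip: rev_map)
  finally have "singular_values M = map sqrt es" by (simp add: rev_map)
  then show ?thesis using that[of es U] len sorted nonneg es U UGU unfolding G_def by blast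
qed

text \<open>Sylvester's determinant identity without division: the block matrix \<open>B\<close> is
  made triangular by \<open>L\<close> from the right and by \<open>K\<close> from the left. It
  serves with c the indeterminate, for characteristic polynomials, and with c = 1, for rank-one
  updates.\<close>

lemma det_smult_one_minus_mult_commute:
  fixes X Y :: "'a :: idom mat"
  assumes X: "X \<in> carrier_mat p q" and Y: "Y \<in> carrier_mat q p"
  shows "c ^ p * det (c \<cdot>\<^sub>m 1\<^sub>m q - Y * X) = c ^ q * det (c \<cdot>\<^sub>m 1\<^sub>m p - X * Y)"
proof -
  define B where "B = four_block_mat (c \<cdot>\<^sub>m 1\<^sub>m q) Y X (1\<^sub>m p)"
  define L where "L = four_block_mat (1\<^sub>m q) (0\<^sub>m q p) (- X) (1\<^sub>m p)"
  define K where "K = four_block_mat (1\<^sub>m q) (0\<^sub>m q p) (- X) (c \<cdot>\<^sub>m 1\<^sub>m p)"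
  have YX: "c \<cdot>\<^sub>m 1\<^sub>m q - Y * X \<in> carrier_mat q q" and XY: "c \<cdot>\<^sub>m 1\<^sub>m p - X * Y \<in> carrier_mat p p"
    using X Y by (auto intro!: minus_carrier_mat)
  have carr: "B \<in> carrier_mat (q + p) (q + p)" "L \<in> carrier_mat (q + p) (q + p)"
    "K \<in> carrier_mat (q + p) (q + p)"
    using X Y by (auto simp: B_def L_def K_def)
  have "B * L = four_block_mat (c \<cdot>\<^sub>m 1\<^sub>m q - Y * X) Y (0\<^sub>m p q) (1\<^sub>m p)"
    unfolding B_def L_def
    by (subst mult_four_block_mat[of _ q q _ p _ p _ _ q _ p])
      (use X Y in \<open>auto intro!: cong_four_block_mat simp: minus_add_uminus_mat\<close>)
  then have "det (B * L) = det (c \<cdot>\<^sub>m 1\<^sub>m q - Y * X)"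
    using det_four_block_mat_lower_left_zero[OF YX Y refl one_carrier_mat] by simp
  moreover have "det L = 1"
    unfolding L_def using X by (simp add: det_four_block_mat_upper_right_zero[of _ q _ p])
  ultimately have 1: "det B = det (c \<cdot>\<^sub>m 1\<^sub>m q - Y * X)"
    using det_mult[OF carr(1,2)] by simp
  have "K * B = four_block_mat (c \<cdot>\<^sub>m 1\<^sub>m q) Y (0\<^sub>m p q) (c \<cdot>\<^sub>m 1\<^sub>m p - X * Y)"
    unfolding B_def K_def
    by (subst mult_four_block_mat[of _ q q _ p _ p _ _ q _ p])
      (use X Y in \<open>auto intro!: cong_four_block_mat eq_matI simp: minus_add_uminus_mat\<close>)
  then have "det (K * B) = c ^ q * det (c \<cdot>\<^sub>m 1\<^sub>m p - X * Y)"
    using det_four_block_mat_lower_left_zero[OF _ Y refl XY, of "c \<cdot>\<^sub>m 1\<^sub>m q"] by simp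
  moreover have "det K = c ^ p"
    unfolding K_def using X by (simp add: det_four_block_mat_upper_right_zero[of _ q _ p])
  ultimately show ?thesis using det_mult[OF carr(3,1)] 1 by simp
qed

lemma char_poly_mult_commute:
  fixes A B :: "'a :: idom mat"
  assumes A: "A \<in> carrier_mat p q" and B: "B \<in> carrier_mat q p"
  shows "[:0, 1:] ^ p * char_poly (B * A) = [:0, 1:] ^ q * char_poly (A * B)"
proof -
  define h where "h = map_mat (\<lambda>a :: 'a. [:a:])"
  have cp: "char_poly (C * D) = det ([:0, 1:] \<cdot>\<^sub>m 1\<^sub>m k - h C * h D)"
    if C: "C \<in> carrier_mat k l" and D: "D \<in> carrier_mat l k" for C D k l
  proof -
    have sum_h: "(\<Sum>x\<in>S. [:f x:]) = [:\<Sum>x\<in>S. f x:]" for S and f :: "nat \<Rightarrow> 'a"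
      by (induction S rule: infinite_finite_induct) auto
    have "char_poly_matrix (C * D) = [:0, 1:] \<cdot>\<^sub>m 1\<^sub>m k - h C * h D"
      using C D unfolding char_poly_matrix_def h_def
      by (intro eq_matI) (auto simp: scalar_prod_def sum_h mult.commute one_pCons)
    then show ?thesis by (simp add: char_poly_def)
  qed
  show ?thesis
    unfolding cp[OF A B] cp[OF B A]
    by (rule det_smult_one_minus_mult_commute) (use A B in \<open>auto simp: h_def\<close>)
qed

section \<open>Volume of a wide matrix as a Gram determinant\<close>

lemma sorted_rev_mset_unique:
  assumes "sorted (rev xs)" "sorted (rev ys)" "mset xs = mset ys"
  shows "xs = ys"
  using assms by (metis mset_rev properties_for_sort rev_rev_ident)

lemma sqrt_prod_list: "sqrt (prod_list xs) = prod_list (map sqrt xs)"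
  by (induction xs) (auto simp: real_sqrt_mult)

lemma det_mult_transpose_nonneg:
  fixes A :: "real mat"
  assumes A: "A \<in> carrier_mat p q"
  shows "0 \<le> det (A * transpose_mat A)"
proof -
  have At: "transpose_mat A \<in> carrier_mat q p" using A by simp
  obtain es U where es: "length es = p" "sorted (rev es)" "\<forall>e\<in>set es. 0 \<le> e"
    "char_poly (A * transpose_mat A) = (\<Prod>e\<leftarrow>es. [:- e, 1:])"
    "singular_values (transpose_mat A) = map sqrt es"
    and U: "U \<in> carrier_mat p p" "transpose_mat U * U = 1\<^sub>m p"
      "transpose_mat U * (A * transpose_mat A) * U = diag_list es"
    by (rule singular_values_spectral[OF At, unfolded transpose_transpose])
  have "det (A * transpose_mat A) = prod_list es"
    using det_orthogonal_conjugation[OF U(1,2), of "A * transpose_mat A"] A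
    by (simp add: U(3) det_diag_list)
  then show ?thesis using es(3) by (simp add: prod_list_nonneg)
qed

text \<open>\<open>rvol\<close> reads the eigenvalues of the q x q matrix A^T A, the determinant
  those of the p x p matrix A A^T. By \<open>char_poly_mult_commute\<close> the two root multisets
  agree after padding with zeros. Since eigenvalues are nonnegative the padded lists are still
  decreasing, hence equal position by position.\<close>

lemma rvol_eq_sqrt_det:
  fixes A :: "real mat"
  assumes A: "A \<in> carrier_mat p q" and pq: "p \<le> q"
  shows "rvol p A = sqrt (det (A * transpose_mat A))"
proof -
  have At: "transpose_mat A \<in> carrier_mat q p" using A by simp
  obtain es V where es: "length es = q" "sorted (rev es)" "\<forall>e\<in>set es. 0 \<le> e"
    "char_poly (transpose_mat A * A) = (\<Prod>e\<leftarrow>es. [:- e, 1:])"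
    "singular_values A = map sqrt es"
    and "V \<in> carrier_mat q q" "transpose_mat V * V = 1\<^sub>m q"
      "transpose_mat V * (transpose_mat A * A) * V = diag_list es"
    by (rule singular_values_spectral[OF A])
  obtain fs U where fs: "length fs = p" "sorted (rev fs)" "\<forall>e\<in>set fs. 0 \<le> e"
    "char_poly (A * transpose_mat A) = (\<Prod>e\<leftarrow>fs. [:- e, 1:])"
    "singular_values (transpose_mat A) = map sqrt fs"
    and U: "U \<in> carrier_mat p p" "transpose_mat U * U = 1\<^sub>m p"
      "transpose_mat U * (A * transpose_mat A) * U = diag_list fs"
    by (rule singular_values_spectral[OF At, unfolded transpose_transpose])
  have det: "det (A * transpose_mat A) = prod_list fs"
    using det_orthogonal_conjugation[OF U(1,2), of "A * transpose_mat A"] A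
    by (simp add: U(3) det_diag_list)
  have pow: "[:0, 1:] ^ k = (\<Prod>e\<leftarrow>replicate k (0 :: real). [:- e, 1:])" for k
    by (induction k) auto
  have "(\<Prod>e\<leftarrow>es @ replicate p 0. [:- e, 1:]) = (\<Prod>e\<leftarrow>fs @ replicate q 0. [:- e, 1:])"
    using char_poly_mult_commute[OF A At] unfolding es(4) fs(4) pow
    by (simp only: map_append prod_list.append mult.commute)
  then have "mset (es @ replicate p 0) = mset (fs @ replicate q 0)"
    by (metis proots_linear_factors)
  moreover have "sorted (rev (es @ replicate p 0))" "sorted (rev (fs @ replicate q 0))"
    using es(2,3) fs(2,3) by (auto simp: sorted_append)
  ultimately have eq: "es @ replicate p 0 = fs @ replicate q 0"
    by (rule sorted_rev_mset_unique[rotated 2])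
  have "rvol p A = (\<Prod>k\<in>{1..p}. sqrt (fs ! (k - 1)))"
    unfolding rvol_def
  proof (intro prod.cong refl)
    fix k assume k: "k \<in> {1..p}"
    have "es ! (k - 1) = (es @ replicate p 0) ! (k - 1)" using k es(1) pq by (auto simp: nth_append)
    also have "\<dots> = fs ! (k - 1)" unfolding eq using k fs(1) by (auto simp: nth_append)
    finally show "singular_value A k = sqrt (fs ! (k - 1))"
      using k pq es(1,5) by (auto simp: singular_value_def)
  qed
  also have "\<dots> = (\<Prod>k\<in>{0..<p}. sqrt (fs ! k))"
    by (rule prod.reindex_bij_witness[of _ Suc "\<lambda>k. k - 1"]) auto
  also have "\<dots> = sqrt (prod_list fs)"
    unfolding sqrt_prod_list by (simp add: prod.list_conv_set_nth fs(1))
  finally show ?thesis using det by simp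
qed

section \<open>Gram determinants\<close>

text \<open>Rows are a family of functions and columns an unordered set, since a Gram determinant
  ignores the order of columns. Choosing rows, deleting a column and bordering become changes of
  \<open>a\<close>, \<open>J\<close> and \<open>p\<close>, without rebuilding matrices.\<close>

definition gram :: "nat \<Rightarrow> (nat \<Rightarrow> 'k \<Rightarrow> real) \<Rightarrow> 'k set \<Rightarrow> real mat" where
  "gram p a J = mat p p (\<lambda>(i, j). \<Sum>k\<in>J. a i k * a j k)"

lemma gram_carrier [simp]: "gram p a J \<in> carrier_mat p p"
  by (simp add: gram_def)

lemma gram_dims [simp]: "dim_row (gram p a J) = p" "dim_col (gram p a J) = p"
  by (simp_all add: gram_def)

lemma gram_index [simp]:
  "i < p \<Longrightarrow> j < p \<Longrightarrow> gram p a J $$ (i, j) = (\<Sum>k\<in>J. a i k * a j k)"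
  by (simp add: gram_def)

lemma transpose_gram: "transpose_mat (gram p a J) = gram p a J"
  by (auto simp: gram_def mult.commute intro!: eq_matI)

lemma gram_cong:
  assumes "\<And>i k. i < p \<Longrightarrow> k \<in> J \<Longrightarrow> a i k = b i k"
  shows "gram p a J = gram p b J"
  using assms by (auto simp: gram_def intro!: cong_mat sum.cong)

lemma gram_reindex:
  assumes "inj_on h K"
  shows "gram p a (h ` K) = gram p (\<lambda>i k. a i (h k)) K"
  by (simp add: gram_def sum.reindex[OF assms] o_def)

lemma mult_transpose_eq_gram:
  assumes "A \<in> carrier_mat p q"
  shows "A * transpose_mat A = gram p (\<lambda>i k. A $$ (i, k)) {..<q}"
  using assms by (auto simp: gram_def scalar_prod_def atLeast0LessThan intro!: eq_matI)

lemma gram_det_nonneg: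
  assumes "finite J"
  shows "0 \<le> det (gram p a J)"
proof -
  obtain h where h: "bij_betw h {0..<card J} J" using ex_bij_betw_nat_finite[OF assms] by blast
  define A where "A = mat p (card J) (\<lambda>(i, k). a i (h k))"
  have A: "A \<in> carrier_mat p (card J)" by (simp add: A_def)
  have "gram p a J = gram p (\<lambda>i k. a i (h k)) {..<card J}"
    using h gram_reindex[of h "{0..<card J}" p a] by (simp add: bij_betw_def atLeast0LessThan)
  also have "\<dots> = A * transpose_mat A"
    unfolding mult_transpose_eq_gram[OF A] by (rule gram_cong) (simp add: A_def)
  finally show ?thesis using det_mult_transpose_nonneg[OF A] by simp
qed

lemma gram_mult_vec:
  assumes "i < p"
  shows "(\<Sum>j<p. gram p a J $$ (i, j) * y j) = (\<Sum>k\<in>J. a i k * (\<Sum>j<p. y j * a j k))"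
proof -
  have "(\<Sum>j<p. gram p a J $$ (i, j) * y j) = (\<Sum>j<p. \<Sum>k\<in>J. a i k * (y j * a j k))"
    using assms by (intro sum.cong refl) (simp add: sum_distrib_left mult_ac)
  also have "\<dots> = (\<Sum>k\<in>J. a i k * (\<Sum>j<p. y j * a j k))"
    by (subst sum.swap) (simp add: sum_distrib_left)
  finally show ?thesis .
qed

lemma gram_bilinear:
  "(\<Sum>i<p. \<Sum>j<p. x i * gram p a J $$ (i, j) * y j) =
     (\<Sum>k\<in>J. (\<Sum>i<p. x i * a i k) * (\<Sum>j<p. y j * a j k))"
proof -
  have "(\<Sum>i<p. \<Sum>j<p. x i * gram p a J $$ (i, j) * y j) =
      (\<Sum>i<p. x i * (\<Sum>j<p. gram p a J $$ (i, j) * y j))"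
    by (simp add: sum_distrib_left mult.assoc del: gram_index)
  also have "\<dots> = (\<Sum>i<p. \<Sum>k\<in>J. x i * a i k * (\<Sum>j<p. y j * a j k))"
    by (intro sum.cong refl) (simp only: gram_mult_vec lessThan_iff sum_distrib_left mult.assoc)
  also have "\<dots> = (\<Sum>k\<in>J. (\<Sum>i<p. x i * a i k) * (\<Sum>j<p. y j * a j k))"
    by (subst sum.swap) (simp add: sum_distrib_right)
  finally show ?thesis .
qed

text \<open>A kernel vector x makes the quadratic form x^T G x vanish, and this form is a sum of
  squares over \<open>J\<close>, so every term is 0.\<close>

lemma gram_det_eq_0_iff:
  assumes J: "finite J"
  shows "det (gram p a J) = 0 \<longleftrightarrow>
    (\<exists>x. (\<exists>i<p. x i \<noteq> 0) \<and> (\<forall>k\<in>J. (\<Sum>i<p. x i * a i k) = 0))"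
proof
  have mv: "(gram p a J *\<^sub>v v) $ i = (\<Sum>j<p. gram p a J $$ (i, j) * v $ j)"
    if "i < p" "v \<in> carrier_vec p" for i v
    using that by (auto simp: scalar_prod_def atLeast0LessThan intro!: sum.cong)
  {
    assume "det (gram p a J) = 0"
    then obtain v where v: "v \<in> carrier_vec p" "v \<noteq> 0\<^sub>v p" and Gv: "gram p a J *\<^sub>v v = 0\<^sub>v p"
      using det_0_iff_vec_prod_zero_field[OF gram_carrier] by blast
    have G0: "(\<Sum>j<p. gram p a J $$ (i, j) * v $ j) = 0" if "i < p" for i
      using mv[OF that v(1)] that by (simp add: Gv)
    have "(\<Sum>k\<in>J. (\<Sum>i<p. v $ i * a i k)\<^sup>2) = (\<Sum>i<p. v $ i * (\<Sum>j<p. gram p a J $$ (i, j) * v $ j))"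
      unfolding power2_eq_square gram_bilinear[symmetric] by (simp only: sum_distrib_left mult.assoc)
    also have "\<dots> = 0" by (rule sum.neutral) (simp add: G0 del: gram_index)
    finally have "\<forall>k\<in>J. (\<Sum>i<p. v $ i * a i k) = 0"
      using J by (subst (asm) sum_nonneg_eq_0_iff) auto
    moreover obtain i where "i < p" "v $ i \<noteq> 0" using v by (metis eq_vecI carrier_vecD index_zero_vec)
    ultimately show "\<exists>x. (\<exists>i<p. x i \<noteq> 0) \<and> (\<forall>k\<in>J. (\<Sum>i<p. x i * a i k) = 0)"
      by (intro exI[of _ "\<lambda>i. v $ i"]) blast
  next
    assume "\<exists>x. (\<exists>i<p. x i \<noteq> 0) \<and> (\<forall>k\<in>J. (\<Sum>i<p. x i * a i k) = 0)"
    then obtain x l where l: "l < p" "x l \<noteq> 0" and x: "\<And>k. k \<in> J \<Longrightarrow> (\<Sum>i<p. x i * a i k) = 0"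
      by blast
    define v where "v = vec p x"
    have v: "v \<in> carrier_vec p" by (simp add: v_def)
    have "v \<noteq> 0\<^sub>v p" using l by (auto simp: v_def dest!: arg_cong[of _ _ "\<lambda>u. u $ l"])
    moreover have "gram p a J *\<^sub>v v = 0\<^sub>v p"
    proof (rule eq_vecI)
      fix i assume "i < dim_vec (0\<^sub>v p :: real vec)"
      then have i: "i < p" by simp
      have "(gram p a J *\<^sub>v v) $ i = (\<Sum>j<p. gram p a J $$ (i, j) * x j)"
        unfolding mv[OF i v] by (intro sum.cong) (auto simp: v_def)
      also have "\<dots> = 0" unfolding gram_mult_vec[OF i] by (simp add: x)
      finally show "(gram p a J *\<^sub>v v) $ i = 0\<^sub>v p $ i" using i by simp
    qed simp
    ultimately show "det (gram p a J) = 0"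
      using det_0_iff_vec_prod_zero_field[OF gram_carrier] v by blast
  }
qed

section \<open>Removing columns from a Gram determinant\<close>

lemma gram_det_mono_nonzero:
  assumes "finite K" "J \<subseteq> K" "det (gram p a J) \<noteq> 0"
  shows "det (gram p a K) \<noteq> 0"
  using assms gram_det_eq_0_iff[of K p a] gram_det_eq_0_iff[of J p a] finite_subset by blast

text \<open>Cofactor signs on the diagonal are +1. Through this the trace of an inverse Gram matrix
  becomes a sum of principal minors, that is, of squared volumes of row subsets, over the
  determinant.\<close>

lemma inverse_matrix_adjugate:
  fixes G :: "real mat"
  assumes G: "G \<in> carrier_mat p p" and det: "det G \<noteq> 0"
  obtains H where "H \<in> carrier_mat p p" "G * H = 1\<^sub>m p" "H * G = 1\<^sub>m p"
    "\<forall>i<p. H $$ (i, i) = det (mat_delete G i i) / det G"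
proof -
  define H where "H = (1 / det G) \<cdot>\<^sub>m adj_mat G"
  note adj = adj_mat[OF G]
  have "H \<in> carrier_mat p p" using adj by (simp add: H_def)
  moreover have "G * H = 1\<^sub>m p"
    unfolding H_def mult_smult_distrib[OF G adj(1)] adj(2) using det by (auto intro!: eq_matI)
  moreover have "H * G = 1\<^sub>m p"
    unfolding H_def mult_smult_assoc_mat[OF adj(1) G] adj(3) using det by (auto intro!: eq_matI)
  moreover have "\<forall>i<p. H $$ (i, i) = det (mat_delete G i i) / det G"
    using G by (simp add: H_def adj_mat_def cofactor_def)
  ultimately show ?thesis using that by blast
qed

text \<open>Removing column w gives G - w w^T = G (1 - H w w^T), and Sylvester's identity with c = 1
  reduces the second determinant to the number 1 - w^T H w. Here w^T H w is the leverage score of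
  the column.\<close>

lemma gram_remove_col:
  assumes J: "finite J" "j \<in> J"
    and H: "H \<in> carrier_mat p p" "gram p a J * H = 1\<^sub>m p"
  shows "det (gram p a (J - {j})) =
    det (gram p a J) * (1 - (\<Sum>i<p. \<Sum>l<p. a i j * H $$ (i, l) * a l j))"
proof -
  define G where "G = gram p a J"
  have G: "G \<in> carrier_mat p p" by (simp add: G_def)
  define w where "w = mat p 1 (\<lambda>(i, _). a i j)"
  have w: "w \<in> carrier_mat p 1" and wt: "transpose_mat w \<in> carrier_mat 1 p"
    by (simp_all add: w_def)
  have Hw: "H * w \<in> carrier_mat p 1" and Hww: "H * w * transpose_mat w \<in> carrier_mat p p"
    using H(1) w by auto
  have ww: "gram p a (J - {j}) = G - w * transpose_mat w"
    using J by (intro eq_matI) (auto simp: G_def w_def scalar_prod_def sum_diff1)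
  have "G * (H * w * transpose_mat w) = G * (H * w) * transpose_mat w"
    using assoc_mult_mat[OF G Hw wt] by simp
  also have "G * (H * w) = w"
    using assoc_mult_mat[OF G H(1) w] H(2) w by (simp add: G_def)
  finally have "G * (1\<^sub>m p - H * w * transpose_mat w) = G - w * transpose_mat w"
    using mult_minus_distrib_mat[OF G one_carrier_mat Hww] G by simp
  then have "det (gram p a (J - {j})) = det G * det (1\<^sub>m p - H * w * transpose_mat w)"
    unfolding ww using det_mult[OF G minus_carrier_mat[OF Hww], of "1\<^sub>m p"] by simp
  also have "det (1\<^sub>m p - H * w * transpose_mat w) = det (1\<^sub>m 1 - transpose_mat w * (H * w))"
  proof -
    have one: "1 \<cdot>\<^sub>m 1\<^sub>m k = (1\<^sub>m k :: real mat)" for k by (intro eq_matI) auto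
    show ?thesis
      using det_smult_one_minus_mult_commute[OF Hw wt, of 1] by (simp add: one)
  qed
  also have "\<dots> = 1 - (transpose_mat w * (H * w)) $$ (0, 0)"
    by (subst det_single) (use w wt Hw in auto)
  also have "(transpose_mat w * (H * w)) $$ (0, 0) = (\<Sum>i<p. a i j * (\<Sum>l<p. H $$ (i, l) * a l j))"
  proof -
    have z: "0 < (1 :: nat)" by simp
    have w0: "w $$ (i, 0) = a i j" if "i < p" for i using that by (simp add: w_def)
    have "(H * w) $$ (i, 0) = (\<Sum>l<p. H $$ (i, l) * a l j)" if "i < p" for i
      unfolding mult_mat_index[OF H(1) w that z] by (simp add: w0)
    moreover have "transpose_mat w $$ (0, i) = a i j" if "i < p" for i
      using that w by (simp add: w0)
    ultimately show ?thesis
      unfolding mult_mat_index[OF wt Hw z z] by (intro sum.cong) auto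
  qed
  finally show ?thesis by (simp add: G_def sum_distrib_left mult.assoc)
qed

text \<open>The leverage scores of all columns add up to tr(H G) = p. A singular Gram matrix stays
  singular under deletion, and then both sides are 0.\<close>

lemma sum_gram_remove_col:
  assumes J: "finite J"
  shows "(\<Sum>j\<in>J. det (gram p a (J - {j}))) = (real (card J) - real p) * det (gram p a J)"
proof (cases "det (gram p a J) = 0")
  case True
  then have "det (gram p a (J - {j})) = 0" for j
    using gram_det_mono_nonzero[OF J, of "J - {j}" p a] by blast
  then show ?thesis by (simp add: True)
next
  case False
  then obtain H where H: "H \<in> carrier_mat p p" "gram p a J * H = 1\<^sub>m p" "H * gram p a J = 1\<^sub>m p"
    using inverse_matrix_adjugate[OF gram_carrier] by metis
  have "(\<Sum>j\<in>J. \<Sum>i<p. \<Sum>l<p. a i j * H $$ (i, l) * a l j)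
      = (\<Sum>i<p. \<Sum>l<p. H $$ (i, l) * (\<Sum>j\<in>J. a l j * a i j))"
    unfolding sum_distrib_left
    by (subst sum.swap, intro sum.cong refl, subst sum.swap) (simp add: mult_ac)
  also have "\<dots> = (\<Sum>i<p. (H * gram p a J) $$ (i, i))"
    by (intro sum.cong refl) (simp add: mult_mat_index[OF H(1) gram_carrier])
  also have "\<dots> = real p" by (simp add: H(3))
  finally have "(\<Sum>j\<in>J. \<Sum>i<p. \<Sum>l<p. a i j * H $$ (i, l) * a l j) = real p" .
  then show ?thesis
    by (simp add: gram_remove_col[OF J _ H(1,2)] sum_subtractf mult.commute flip: sum_distrib_left)
qed

section \<open>Bordering a Gram determinant by one row\<close>

lemma mat_delete_gram:
  assumes "i < Suc p"
  shows "mat_delete (gram (Suc p) a J) i i = gram p (\<lambda>l. a (insert_index i l)) J"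
  using assms by (auto simp: mat_delete_def gram_def insert_index_def intro!: eq_matI)

lemma gram_left_mult:
  assumes L: "L \<in> carrier_mat s p"
  shows "gram s (\<lambda>i k. \<Sum>l<p. L $$ (i, l) * a l k) J = L * gram p a J * transpose_mat L"
proof (rule eq_matI)
  fix i j assume "i < dim_row (L * gram p a J * transpose_mat L)"
    "j < dim_col (L * gram p a J * transpose_mat L)"
  then have ij: "i < s" "j < s" using L by auto
  have "(L * gram p a J * transpose_mat L) $$ (i, j)
      = (\<Sum>l<p. (L * gram p a J) $$ (i, l) * transpose_mat L $$ (l, j))"
    by (rule mult_mat_index[of _ s p _ s]) (use L ij in auto)
  also have "\<dots> = (\<Sum>l<p. \<Sum>h<p. L $$ (i, h) * gram p a J $$ (h, l) * L $$ (j, l))"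
    using L ij by (intro sum.cong refl)
      (simp add: mult_mat_index[OF L gram_carrier] sum_distrib_right del: index_mult_mat)
  also have "\<dots> = (\<Sum>k\<in>J. (\<Sum>l<p. L $$ (i, l) * a l k) * (\<Sum>l<p. L $$ (j, l) * a l k))"
    by (subst sum.swap) (rule gram_bilinear)
  finally show "gram s (\<lambda>i k. \<Sum>l<p. L $$ (i, l) * a l k) J $$ (i, j)
      = (L * gram p a J * transpose_mat L) $$ (i, j)"
    using ij by simp
qed (use L in auto)

text \<open>The unit lower triangular \<open>L\<close> adds the combination back to the last row, so
  the two Gram matrices are congruent through a matrix of determinant 1.\<close>

lemma gram_last_row_op:
  "det (gram (Suc p) (\<lambda>i k. if i = p then a p k - (\<Sum>l<p. x l * a l k) else a i k) J)
     = det (gram (Suc p) a J)"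
proof -
  define b where "b = (\<lambda>i k. if i = p then a p k - (\<Sum>l<p. x l * a l k) else a i k)"
  define L where "L = mat (Suc p) (Suc p) (\<lambda>(i, j). if i = j then 1 else if i = p then x j else 0)"
  have L: "L \<in> carrier_mat (Suc p) (Suc p)" by (simp add: L_def)
  have "diag_mat L = map (\<lambda>_. 1) [0..<Suc p]"
    unfolding diag_mat_def by (intro map_cong) (auto simp: L_def)
  then have "prod_list (diag_mat L) = 1"
    by (simp only: map_replicate_const prod_list_replicate power_one)
  then have detL: "det L = 1"
    by (subst det_lower_triangular[OF _ L]) (auto simp: L_def)
  have "gram (Suc p) a J = gram (Suc p) (\<lambda>i k. \<Sum>l<Suc p. L $$ (i, l) * b l k) J"
  proof (rule gram_cong)
    fix i k assume i: "i < Suc p"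
    have "(\<Sum>l<p. (if i = l then 1 else if i = p then x l else 0) * a l k)
        = (if i = p then \<Sum>l<p. x l * a l k else a i k)"
      using i by (auto simp: if_distrib[of "\<lambda>c. c * _"] cong: if_cong intro!: sum.cong)
    then show "a i k = (\<Sum>l<Suc p. L $$ (i, l) * b l k)"
      using i by (simp add: L_def b_def)
  qed
  also have "\<dots> = L * gram (Suc p) b J * transpose_mat L"
    by (rule gram_left_mult[OF L])
  also have "det \<dots> = det (gram (Suc p) b J)"
    using L detL by (simp add: det_mult[of _ "Suc p"] det_transpose[OF L])
  finally show ?thesis by (simp add: b_def)
qed

lemma gram_orthogonal_last:
  assumes "\<And>i. i < p \<Longrightarrow> (\<Sum>k\<in>J. a i k * a p k) = 0"
  shows "det (gram (Suc p) a J) = det (gram p a J) * (\<Sum>k\<in>J. (a p k)\<^sup>2)"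
proof -
  define s where "s = mat 1 1 (\<lambda>_. \<Sum>k\<in>J. (a p k)\<^sup>2)"
  have s: "s \<in> carrier_mat 1 1" by (simp add: s_def)
  have "gram (Suc p) a J = four_block_mat (gram p a J) (0\<^sub>m p 1) (0\<^sub>m 1 p) s"
    using assms
    by (intro eq_matI) (auto simp: s_def power2_eq_square less_Suc_eq mult.commute)
  moreover have "det s = (\<Sum>k\<in>J. (a p k)\<^sup>2)"
    unfolding det_single[OF s] by (simp add: s_def)
  ultimately show ?thesis
    using det_four_block_mat_lower_left_zero[OF gram_carrier[of p a J] _ refl s, of "0\<^sub>m p 1"]
    by simp
qed

text \<open>For j in \<open>J\<close> the residual is orthogonal to the other rows on the whole
  column set, so the determinant is a product and one square of its last factor is kept. Otherwise
  orthogonality on \<open>K\<close> fails only through column j; the corrected residual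
  \<open>e\<close> restores it.\<close>

lemma gram_residual_bound:
  fixes a :: "nat \<Rightarrow> 'k \<Rightarrow> real"
  assumes J: "finite J" and det: "det (gram p a J) \<noteq> 0"
    and r: "\<And>k. r k = a p k - (\<Sum>l<p. x l * a l k)"
    and orth: "\<And>i. i < p \<Longrightarrow> (\<Sum>k\<in>J. a i k * r k) = 0"
  shows "det (gram p a J) * (r j)\<^sup>2 \<le> det (gram (Suc p) a (insert j J))"
proof -
  define K where "K = insert j J"
  have K: "finite K" "J \<subseteq> K" "j \<in> K" using J by (auto simp: K_def)
  define b where "b = (\<lambda>i k. if i = p then r k else a i k)"
  have ab: "det (gram (Suc p) a K) = det (gram (Suc p) b K)"
    unfolding b_def r by (rule gram_last_row_op[symmetric])
  show ?thesis
  proof (cases "j \<in> J")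
    case True
    then have KJ: "K = J" by (auto simp: K_def)
    have "det (gram (Suc p) b J) = det (gram p b J) * (\<Sum>k\<in>J. (b p k)\<^sup>2)"
      by (rule gram_orthogonal_last) (simp add: b_def orth)
    also have "gram p b J = gram p a J" by (rule gram_cong) (simp add: b_def)
    finally have eq: "det (gram (Suc p) a J) = det (gram p a J) * (\<Sum>k\<in>J. (r k)\<^sup>2)"
      using ab unfolding KJ by (simp add: b_def)
    have "(r j)\<^sup>2 \<le> (\<Sum>k\<in>J. (r k)\<^sup>2)"
      using True J by (intro member_le_sum) auto
    then show ?thesis
      unfolding K_def[symmetric] KJ eq by (intro mult_left_mono gram_det_nonneg J)
  next
    case False
    define P where "P = gram p a K"
    have "det P \<noteq> 0" unfolding P_def using gram_det_mono_nonzero[OF K(1,2) det] .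
    then obtain H where H: "H \<in> carrier_mat p p" "P * H = 1\<^sub>m p"
      using inverse_matrix_adjugate[of P p] by (metis P_def gram_carrier)
    have P: "P \<in> carrier_mat p p" by (simp add: P_def)
    \<comment> \<open>On \<open>K\<close> the inner product of r with row i is
      \<open>a i j * r j\<close>, since only the new column contributes; y solves the normal
      equations for this right-hand side.\<close>
    define y where "y l = r j * (\<Sum>h<p. H $$ (l, h) * a h j)" for l
    have Py: "(\<Sum>l<p. P $$ (i, l) * y l) = r j * a i j" if i: "i < p" for i
    proof -
      have "(\<Sum>l<p. P $$ (i, l) * y l) = r j * (\<Sum>l<p. \<Sum>h<p. P $$ (i, l) * H $$ (l, h) * a h j)"
        unfolding y_def by (simp add: sum_distrib_left mult_ac)
      also have "(\<Sum>l<p. \<Sum>h<p. P $$ (i, l) * H $$ (l, h) * a h j) = (\<Sum>h<p. (P * H) $$ (i, h) * a h j)"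
        by (subst sum.swap) (use i in \<open>auto simp: mult_mat_index[OF P H(1)] sum_distrib_right
            simp del: index_mult_mat intro!: sum.cong\<close>)
      also have "\<dots> = (\<Sum>h<p. if h = i then a h j else 0)"
        unfolding H(2) using i by (intro sum.cong) auto
      finally show ?thesis using i by simp
    qed
    define e where "e k = r k - (\<Sum>l<p. y l * a l k)" for k
    define c where "c = (\<lambda>i k. if i = p then e k else a i k)"
    have "det (gram (Suc p) b K) =
        det (gram (Suc p) (\<lambda>i k. if i = p then b p k - (\<Sum>l<p. y l * b l k) else b i k) K)"
      by (rule gram_last_row_op[symmetric])
    also have "gram (Suc p) (\<lambda>i k. if i = p then b p k - (\<Sum>l<p. y l * b l k) else b i k) K = gram (Suc p) c K"
      by (rule gram_cong) (auto simp: b_def c_def e_def)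
    finally have bc: "det (gram (Suc p) b K) = det (gram (Suc p) c K)" .
    have ar: "(\<Sum>k\<in>K. a i k * r k) = a i j * r j" if "i < p" for i
      using False J orth[OF that] by (simp add: K_def)
    have ae: "(\<Sum>k\<in>K. a i k * e k) = 0" if i: "i < p" for i
      using Py[OF i] gram_mult_vec[OF i, of a K y] ar[OF i]
      by (simp add: e_def P_def right_diff_distrib sum_subtractf)
    have cK: "det (gram (Suc p) c K) = det (gram p c K) * (\<Sum>k\<in>K. (c p k)\<^sup>2)"
      by (rule gram_orthogonal_last) (simp add: c_def ae)
    have "gram p c K = P" unfolding P_def by (rule gram_cong) (simp add: c_def)
    with cK have det_e: "det (gram (Suc p) a K) = det P * (\<Sum>k\<in>K. (e k)\<^sup>2)"
      using ab bc by (simp add: c_def)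
    \<comment> \<open>The leverage score of column j in \<open>K\<close>. The factor 1 - \<beta>
      multiplies \<open>(r j)\<^sup>2\<close> in the squared length of \<open>e\<close>, and it also
      takes \<open>det P\<close> to the determinant on \<open>J\<close>; this is why the bound loses
      no constant.\<close>
    define \<beta> where "\<beta> = (\<Sum>i<p. \<Sum>l<p. a i j * H $$ (i, l) * a l j)"
    have lin: "(\<Sum>k\<in>K. (\<Sum>l<p. y l * a l k) * f k) = (\<Sum>l<p. y l * (\<Sum>k\<in>K. a l k * f k))" for f
      unfolding sum_distrib_left sum_distrib_right by (subst sum.swap) (simp add: mult_ac)
    have "(\<Sum>k\<in>K. (e k)\<^sup>2) = (\<Sum>k\<in>K. r k * e k) - (\<Sum>k\<in>K. (\<Sum>l<p. y l * a l k) * e k)"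
      unfolding sum_subtractf[symmetric] by (intro sum.cong) (auto simp: e_def power2_eq_square algebra_simps)
    also have "\<dots> = (\<Sum>k\<in>K. r k * e k)" unfolding lin by (simp add: ae)
    also have "\<dots> = (\<Sum>k\<in>K. (r k)\<^sup>2) - (\<Sum>k\<in>K. (\<Sum>l<p. y l * a l k) * r k)"
      unfolding sum_subtractf[symmetric] by (intro sum.cong) (auto simp: e_def power2_eq_square algebra_simps)
    also have "(\<Sum>k\<in>K. (\<Sum>l<p. y l * a l k) * r k) = (\<Sum>l<p. y l * (a l j * r j))"
      unfolding lin by (intro sum.cong refl) (simp add: ar)
    also have "\<dots> = (r j)\<^sup>2 * \<beta>"
      by (simp add: y_def \<beta>_def sum_distrib_left power2_eq_square mult_ac)
    also have "(\<Sum>k\<in>K. (r k)\<^sup>2) = (r j)\<^sup>2 + (\<Sum>k\<in>J. (r k)\<^sup>2)"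
      using False J by (simp add: K_def)
    finally have e2: "(\<Sum>k\<in>K. (e k)\<^sup>2) = (r j)\<^sup>2 + (\<Sum>k\<in>J. (r k)\<^sup>2) - (r j)\<^sup>2 * \<beta>" .
    have "K - {j} = J" using False by (auto simp: K_def)
    then have detJ: "det (gram p a J) = det P * (1 - \<beta>)"
      using gram_remove_col[OF K(1,3) H(1)] H(2) by (simp add: P_def \<beta>_def)
    have "det (gram (Suc p) a K) = det (gram p a J) * (r j)\<^sup>2 + det P * (\<Sum>k\<in>J. (r k)\<^sup>2)"
      unfolding det_e e2 detJ by (simp add: algebra_simps)
    moreover have "0 \<le> det P * (\<Sum>k\<in>J. (r k)\<^sup>2)"
      unfolding P_def by (intro mult_nonneg_nonneg gram_det_nonneg sum_nonneg K) auto
    ultimately show ?thesis by (simp add: K_def)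
  qed
qed

section \<open>Trace of an inverse Gram matrix\<close>

text \<open>With \<open>es\<close> decreasing, the sum is least when the total weight t sits on the
  t largest entries: against the threshold c the product (w j - [j < t]) (1 / es ! j - c) is never
  negative, and c drops out on summing because both weightings total t. An entry 0 among the first t
  would confine the weight to fewer than t places.\<close>

lemma weighted_inverse_sum_bound:
  fixes es :: "real list" and w :: "nat \<Rightarrow> real"
  assumes sorted: "sorted (rev es)" and nonneg: "\<forall>e\<in>set es. 0 \<le> e" and len: "length es = n"
    and w: "\<And>j. j < n \<Longrightarrow> 0 \<le> w j" "\<And>j. j < n \<Longrightarrow> w j \<le> 1"
    and w0: "\<And>j. j < n \<Longrightarrow> es ! j = 0 \<Longrightarrow> w j = 0"
    and sum: "(\<Sum>j<n. w j) = real t"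
  shows "t \<le> n" "\<And>j. j < t \<Longrightarrow> 0 < es ! j" "(\<Sum>j<t. 1 / es ! j) \<le> (\<Sum>j<n. w j / es ! j)"
proof -
  have dec: "es ! j \<le> es ! i" if "i \<le> j" "j < n" for i j
    using sorted that len by (simp add: sorted_rev_nth_mono)
  have pos0: "0 \<le> es ! j" if "j < n" for j using nonneg len that by auto
  have "(\<Sum>j<n. w j) \<le> (\<Sum>j<n. 1)" using w by (intro sum_mono) auto
  then show tn: "t \<le> n" using sum by simp
  show pos: "0 < es ! j" if j: "j < t" for j
  proof (rule ccontr)
    assume "\<not> 0 < es ! j"
    then have "es ! i = 0" if "j \<le> i" "i < n" for i
      using dec[OF that] pos0[OF that(2)] by simp
    then have "(\<Sum>i<n. w i) = (\<Sum>i<j. w i)"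
      using w0 j tn by (intro sum.mono_neutral_right) (auto simp: not_less)
    also have "\<dots> \<le> (\<Sum>i<j. 1)" using w j tn by (intro sum_mono) auto
    finally show False using sum j by simp
  qed
  show "(\<Sum>j<t. 1 / es ! j) \<le> (\<Sum>j<n. w j / es ! j)"
  proof (cases "t = 0")
    case True
    then show ?thesis using w pos0 by (auto intro!: sum_nonneg divide_nonneg_nonneg)
  next
    case False
    define c where "c = 1 / es ! (t - 1)"
    have t1: "t - 1 < n" and p1: "0 < es ! (t - 1)" using False tn pos by auto
    have le: "w j * c + (if j < t then 1 / es ! j - c else 0) \<le> w j / es ! j" if j: "j < n" for j
    proof (cases "j < t")
      case True
      have "1 / es ! j \<le> c"
        unfolding c_def using dec[of j "t - 1"] True t1 p1 by (intro divide_left_mono) (auto simp: pos)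
      then have "0 \<le> (1 - w j) * (c - 1 / es ! j)" using w[OF j] by simp
      then show ?thesis using True by (simp add: algebra_simps diff_divide_distrib)
    next
      case False
      \<comment> \<open>At a zero eigenvalue the quotient is 0 by convention, and so is the
        weight.\<close>
      show ?thesis
      proof (cases "es ! j = 0")
        case True
        then show ?thesis using False w0[OF j] by simp
      next
        case nz: False
        then have "c \<le> 1 / es ! j"
          unfolding c_def using dec[of "t - 1" j] False j p1 pos0[OF j]
          by (intro divide_left_mono) auto
        then show ?thesis using False w[OF j] mult_left_mono[of c "1 / es ! j" "w j"] by simp
      qed
    qed
    have restrict: "(\<Sum>j<n. if j < t then 1 / es ! j - c else 0) = (\<Sum>j<t. 1 / es ! j - c)"
      using tn by (intro sum.mono_neutral_cong_right) auto
    have "(\<Sum>j<t. 1 / es ! j) = (\<Sum>j<n. w j * c + (if j < t then 1 / es ! j - c else 0))"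
      unfolding sum.distrib restrict by (simp add: sum sum_subtractf flip: sum_distrib_right)
    also have "\<dots> \<le> (\<Sum>j<n. w j / es ! j)" using le by (intro sum_mono) auto
    finally show ?thesis .
  qed
qed

lemma mult_diag_list:
  assumes "A \<in> carrier_mat m (length es)" "i < m" "j < length es"
  shows "(A * diag_list es) $$ (i, j) = A $$ (i, j) * es ! j"
proof -
  have "(A * diag_list es) $$ (i, j) = (\<Sum>k<length es. if k = j then A $$ (i, j) * es ! j else 0)"
    unfolding mult_mat_index[OF assms(1) diag_list_carrier assms(2,3)]
    using assms by (intro sum.cong) (auto simp: diag_list_def)
  then show ?thesis using assms by simp
qed

text \<open>With \<open>Z\<close> the submatrix of \<open>M\<close> and \<open>R\<close> its pseudoinverse \<open>Z\<^sup>T H\<close> padded by zero rows,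
  the rows \<open>f\<close> of \<open>M R\<close> form the identity, so \<open>T = R\<^sup>T M\<^sup>T M R \<ge> 1\<close>. In an eigenbasis of \<open>M\<^sup>T M\<close>,
  \<open>T\<close> is a sum of rank-one terms \<open>s\<^sub>j s\<^sub>j\<^sup>T\<close>; the leverage scores \<open>w\<^sub>j = s\<^sub>j\<^sup>T T\<^sup>-\<^sup>1 s\<^sub>j\<close> lie between
  0 and 1, sum to \<open>t\<close>, and satisfy \<open>w\<^sub>j \<le> |s\<^sub>j|\<^sup>2\<close> because \<open>T\<^sup>-\<^sup>1 \<le> 1\<close>.\<close>

lemma trace_inverse_gram_bound:
  fixes M H :: "real mat"
  assumes M: "M \<in> carrier_mat m n"
    and f: "inj_on f {..<t}" "f ` {..<t} \<subseteq> {..<m}" and J: "J \<subseteq> {..<n}"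
    and H: "H \<in> carrier_mat t t" "gram t (\<lambda>i k. M $$ (f i, k)) J * H = 1\<^sub>m t"
  shows "t \<le> n \<and> (\<forall>k\<in>{1..t}. 0 < singular_value M k) \<and>
    (\<Sum>k = 1..t. inverse ((singular_value M k)\<^sup>2)) \<le> (\<Sum>i<t. H $$ (i, i))"
proof -
  obtain es U where len: "length es = n" and sorted: "sorted (rev es)"
    and nonneg: "\<forall>e\<in>set es. 0 \<le> e"
    and "char_poly (transpose_mat M * M) = (\<Prod>e\<leftarrow>es. [:- e, 1:])"
    and sv: "singular_values M = map sqrt es"
    and U: "U \<in> carrier_mat n n" "transpose_mat U * U = 1\<^sub>m n"
    and UMU: "transpose_mat U * (transpose_mat M * M) * U = diag_list es"
    by (rule singular_values_spectral[OF M])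
  have pos0: "0 \<le> es ! j" if "j < n" for j using nonneg len that by auto
  define a where "a = (\<lambda>i k. M $$ (f i, k))"
  define G where "G = gram t a J"
  have GH: "G * H = 1\<^sub>m t" using H by (simp add: G_def a_def)
  have G: "G \<in> carrier_mat t t" by (simp add: G_def)
  define R where "R = mat n t (\<lambda>(k, c). if k \<in> J then \<Sum>b<t. H $$ (b, c) * a b k else 0)"
  have R: "R \<in> carrier_mat n t" by (simp add: R_def)
  define S where "S = transpose_mat U * R"
  have S: "S \<in> carrier_mat n t" using U R by (simp add: S_def)
  have Ut: "transpose_mat U \<in> carrier_mat n n" and Mt: "transpose_mat M \<in> carrier_mat n m"
    and St: "transpose_mat S \<in> carrier_mat t n" and Rt: "transpose_mat R \<in> carrier_mat t n"
    using U M S R by auto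
  define Y where "Y = M * R"
  have Y: "Y \<in> carrier_mat m t" and Yt: "transpose_mat Y \<in> carrier_mat t m"
    using M R by (auto simp: Y_def)
  note UU' = orthogonal_transpose_right_inverse[OF U]
  have US: "U * S = R"
    unfolding S_def using assoc_mult_mat[OF U(1) Ut R] UU' R by simp

  have sumJ: "(\<Sum>k<n. g k * (if k \<in> J then h k else 0)) = (\<Sum>k\<in>J. g k * h k)" for g h :: "nat \<Rightarrow> real"
    using J by (intro sum.mono_neutral_cong_right) auto
  have YI: "Y $$ (f b, c) = 1\<^sub>m t $$ (b, c)" if bc: "b < t" "c < t" for b c
  proof -
    have "f b < m" using f bc by auto
    then have "Y $$ (f b, c) = (\<Sum>k<n. M $$ (f b, k) * R $$ (k, c))"
      unfolding Y_def using mult_mat_index[OF M R] bc by simp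
    also have "\<dots> = (\<Sum>k\<in>J. a b k * (\<Sum>d<t. H $$ (d, c) * a d k))"
      unfolding sumJ[symmetric] using bc by (intro sum.cong) (auto simp: R_def a_def)
    also have "\<dots> = (G * H) $$ (b, c)"
      unfolding G_def mult_mat_index[OF gram_carrier H(1) bc] gram_mult_vec[OF bc(1)] ..
    finally show ?thesis by (simp add: GH)
  qed
  \<comment> \<open>R^T R = H^T G H = H^T, so the diagonals agree.\<close>
  have trR: "(\<Sum>c<t. (transpose_mat R * R) $$ (c, c)) = (\<Sum>c<t. H $$ (c, c))"
  proof (intro sum.cong refl)
    fix c assume "c \<in> {..<t}"
    then have c: "c < t" by simp
    have "(transpose_mat R * R) $$ (c, c) = (\<Sum>k<n. R $$ (k, c) * R $$ (k, c))"
      unfolding mult_mat_index[OF Rt R c c] using R c by (intro sum.cong) auto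
    also have "\<dots> = (\<Sum>k\<in>J. (\<Sum>b<t. H $$ (b, c) * a b k) * (\<Sum>b<t. H $$ (b, c) * a b k))"
      unfolding sumJ[symmetric] using c by (intro sum.cong) (auto simp: R_def)
    also have "\<dots> = (\<Sum>b<t. H $$ (b, c) * (\<Sum>d<t. G $$ (b, d) * H $$ (d, c)))"
      unfolding gram_bilinear[symmetric] G_def by (simp only: sum_distrib_left mult.assoc)
    also have "\<dots> = (\<Sum>b<t. H $$ (b, c) * (G * H) $$ (b, c))"
      using c by (intro sum.cong) (auto simp: mult_mat_index[OF G H(1)] simp del: index_mult_mat)
    also have "\<dots> = (\<Sum>b<t. if b = c then H $$ (c, c) else 0)"
      unfolding GH using c by (intro sum.cong) auto
    finally show "(transpose_mat R * R) $$ (c, c) = H $$ (c, c)" using c by simp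
  qed
  have SS: "transpose_mat S * S = transpose_mat R * R"
  proof -
    have "transpose_mat R * R = transpose_mat S * transpose_mat U * (U * S)"
      using transpose_mult[OF U(1) S] by (simp add: US)
    also have "\<dots> = transpose_mat S * (transpose_mat U * (U * S))"
      using assoc_mult_mat[OF St Ut, of "U * S" t] U S by simp
    also have "transpose_mat U * (U * S) = S"
      using assoc_mult_mat[OF Ut U(1) S] U S by simp
    finally show ?thesis by simp
  qed
  \<comment> \<open>Row j of \<open>S\<close> holds coordinates of \<open>R\<close> along
    eigenvector j; scaled by the singular value, these rows have Gram matrix S^T diag(es) S.\<close>
  define s where "s = (\<lambda>c j. sqrt (es ! j) * S $$ (j, c))"
  define T where "T = gram t s {..<n}"
  have T: "T \<in> carrier_mat t t" by (simp add: T_def)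
  \<comment> \<open>A second Gram form of \<open>T\<close>, over the rows of M R instead of the
    eigendirections: the spectral form carries the weights, this one shows that \<open>T\<close>
    dominates the identity.\<close>
  have TY: "T = gram t (\<lambda>c i. Y $$ (i, c)) {..<m}"
  proof -
    have YS: "Y = M * U * S"
      unfolding Y_def US[symmetric] using assoc_mult_mat[OF M U(1) S] by simp
    have MU: "M * U \<in> carrier_mat m n" and MUt: "transpose_mat (M * U) \<in> carrier_mat n m"
      using M U by auto
    have D: "transpose_mat (M * U) * (M * U) = diag_list es"
    proof -
      have "transpose_mat (M * U) * (M * U) = transpose_mat U * transpose_mat M * (M * U)"
        by (simp add: transpose_mult[OF M U(1)])
      also have "\<dots> = transpose_mat U * (transpose_mat M * (M * U))"
        by (rule assoc_mult_mat[OF Ut Mt MU])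
      also have "transpose_mat M * (M * U) = transpose_mat M * M * U"
        using assoc_mult_mat[OF Mt M U(1)] by simp
      also have "transpose_mat U * (transpose_mat M * M * U) = diag_list es"
        using assoc_mult_mat[OF Ut _ U(1), of "transpose_mat M * M"] M UMU by simp
      finally show ?thesis .
    qed
    have "gram t (\<lambda>c i. Y $$ (i, c)) {..<m} = gram t (\<lambda>c i. transpose_mat Y $$ (c, i)) {..<m}"
      using Y by (intro gram_cong) auto
    also have "\<dots> = transpose_mat Y * Y"
      using mult_transpose_eq_gram[OF Yt] by simp
    also have "\<dots> = transpose_mat S * transpose_mat (M * U) * (M * U * S)"
      unfolding YS transpose_mult[OF MU S] ..
    also have "\<dots> = transpose_mat S * (transpose_mat (M * U) * (M * U * S))"
      by (rule assoc_mult_mat[OF St MUt mult_carrier_mat[OF MU S]])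
    also have "transpose_mat (M * U) * (M * U * S) = diag_list es * S"
      using assoc_mult_mat[OF MUt MU S] by (simp add: D)
    also have "transpose_mat S * (diag_list es * S) = transpose_mat S * diag_list es * S"
      using assoc_mult_mat[OF St _ S, of "diag_list es"] len diag_list_carrier[of es] by simp
    also have "\<dots> = T"
    proof (rule eq_matI)
      have SD: "transpose_mat S * diag_list es \<in> carrier_mat t n"
        using St len diag_list_carrier[of es] by (metis mult_carrier_mat)
      fix b c assume "b < dim_row T" "c < dim_col T"
      then have bc: "b < t" "c < t" by (auto simp: T_def)
      have "(transpose_mat S * diag_list es * S) $$ (b, c)
          = (\<Sum>j<n. (transpose_mat S * diag_list es) $$ (b, j) * S $$ (j, c))"
        by (rule mult_mat_index[OF SD S bc])
      also have "\<dots> = (\<Sum>j<n. s b j * s c j)"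
      proof (intro sum.cong refl)
        fix j assume "j \<in> {..<n}"
        then have j: "j < n" by simp
        have "(transpose_mat S * diag_list es) $$ (b, j) = S $$ (j, b) * es ! j"
          using mult_diag_list[of "transpose_mat S" t es b j] St S len bc j by simp
        moreover have "sqrt (es ! j) * sqrt (es ! j) = es ! j" using pos0[OF j] by simp
        ultimately show "(transpose_mat S * diag_list es) $$ (b, j) * S $$ (j, c) = s b j * s c j"
          by (simp add: s_def mult_ac)
      qed
      finally show "(transpose_mat S * diag_list es * S) $$ (b, c) = T $$ (b, c)"
        using bc by (simp add: T_def)
    qed (use S len in \<open>auto simp: T_def\<close>)
    finally show ?thesis by simp
  qed
  \<comment> \<open>The rows of M R selected by f are the unit vectors and account for the left
    side; the other rows only add squares.\<close>
  have quad: "(\<Sum>c<t. (x c)\<^sup>2) \<le> (\<Sum>j<n. (\<Sum>c<t. x c * s c j)\<^sup>2)" for x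
  proof -
    have "(\<Sum>b<t. (x b)\<^sup>2) = (\<Sum>b<t. (\<Sum>c<t. x c * Y $$ (f b, c))\<^sup>2)"
    proof (intro sum.cong refl)
      fix b assume "b \<in> {..<t}"
      then have b: "b < t" by simp
      have "(\<Sum>c<t. x c * Y $$ (f b, c)) = (\<Sum>c<t. if c = b then x b else 0)"
        using b by (intro sum.cong) (auto simp: YI)
      then show "(x b)\<^sup>2 = (\<Sum>c<t. x c * Y $$ (f b, c))\<^sup>2" using b by simp
    qed
    also have "\<dots> = (\<Sum>i\<in>f ` {..<t}. (\<Sum>c<t. x c * Y $$ (i, c))\<^sup>2)"
      by (simp add: sum.reindex[OF f(1)])
    also have "\<dots> \<le> (\<Sum>i<m. (\<Sum>c<t. x c * Y $$ (i, c))\<^sup>2)"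
      using f(2) by (intro sum_mono2) auto
    also have "\<dots> = (\<Sum>i<t. \<Sum>j<t. x i * T $$ (i, j) * x j)"
      unfolding TY gram_bilinear power2_eq_square ..
    also have "\<dots> = (\<Sum>j<n. (\<Sum>c<t. x c * s c j)\<^sup>2)"
      unfolding T_def gram_bilinear power2_eq_square ..
    finally show ?thesis .
  qed
  have "det T \<noteq> 0"
  proof
    assume "det T = 0"
    then obtain x i where i: "i < t" "x i \<noteq> 0" and x: "\<And>j. j < n \<Longrightarrow> (\<Sum>c<t. x c * s c j) = 0"
      unfolding T_def gram_det_eq_0_iff[OF finite_lessThan] by auto
    have "0 < (\<Sum>c<t. (x c)\<^sup>2)" by (rule sum_pos2[of _ i]) (use i in auto)
    then show False using quad[of x] by (simp add: x)
  qed
  then obtain K where K: "K \<in> carrier_mat t t" "T * K = 1\<^sub>m t" "K * T = 1\<^sub>m t"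
    using inverse_matrix_adjugate[OF T] by metis
  define y where "y = (\<lambda>j c. \<Sum>b<t. K $$ (c, b) * s b j)"
  define w where "w j = (\<Sum>c<t. y j c * s c j)" for j
  have Ty: "(\<Sum>b<t. T $$ (c, b) * y j b) = s c j" if c: "c < t" for c j
  proof -
    have "(\<Sum>b<t. T $$ (c, b) * y j b) = (\<Sum>d<t. (T * K) $$ (c, d) * s d j)"
      unfolding y_def sum_distrib_left
      by (subst sum.swap)
        (use c in \<open>auto simp: mult_mat_index[OF T K(1)] sum_distrib_right mult.assoc
          simp del: index_mult_mat intro!: sum.cong\<close>)
    also have "\<dots> = (\<Sum>d<t. if d = c then s c j else 0)"
      unfolding K(2) using c by (intro sum.cong) auto
    finally show ?thesis using c by simp
  qed
  have w_sq: "w j = (\<Sum>l<n. (\<Sum>c<t. y j c * s c l)\<^sup>2)" for j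
  proof -
    have "(\<Sum>l<n. (\<Sum>c<t. y j c * s c l)\<^sup>2) = (\<Sum>c<t. y j c * (\<Sum>b<t. T $$ (c, b) * y j b))"
      unfolding power2_eq_square gram_bilinear[symmetric] T_def
      by (simp only: sum_distrib_left mult.assoc)
    then show ?thesis by (simp add: Ty w_def)
  qed
  have w0: "0 \<le> w j" for j unfolding w_sq by (intro sum_nonneg) auto
  \<comment> \<open>The square of \<open>w j\<close> is the term l = j of the sum of squares that
    equals \<open>w j\<close>.\<close>
  have w1: "w j \<le> 1" if j: "j < n" for j
  proof -
    have "(w j)\<^sup>2 = (\<Sum>c<t. y j c * s c j)\<^sup>2" by (simp add: w_def)
    also have "\<dots> \<le> (\<Sum>l<n. (\<Sum>c<t. y j c * s c l)\<^sup>2)"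
      using j member_le_sum[of j "{..<n}" "\<lambda>l. (\<Sum>c<t. y j c * s c l)\<^sup>2"] by simp
    also have "\<dots> = w j" by (rule w_sq[symmetric])
    finally have "w j * w j \<le> 1 * w j" by (simp add: power2_eq_square)
    then show ?thesis
      using mult_strict_right_mono[of 1 "w j" "w j"] by linarith
  qed
  \<comment> \<open>Expanding |s_j - y_j|^2 >= 0 and using |y_j|^2 <= y_j^T T y_j = w_j gives the
    bound directly, without comparing inverse matrices.\<close>
  have w_le: "w j \<le> es ! j * (\<Sum>c<t. (S $$ (j, c))\<^sup>2)" if j: "j < n" for j
  proof -
    have "0 \<le> (\<Sum>c<t. (s c j - y j c)\<^sup>2)" by (intro sum_nonneg) auto
    also have "\<dots> = (\<Sum>c<t. (s c j)\<^sup>2) - 2 * w j + (\<Sum>c<t. (y j c)\<^sup>2)"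
      unfolding w_def sum_distrib_left sum_subtractf[symmetric] sum.distrib[symmetric]
      by (intro sum.cong) (auto simp: power2_eq_square algebra_simps)
    also have "(\<Sum>c<t. (y j c)\<^sup>2) \<le> w j" unfolding w_sq by (rule quad)
    finally have "w j \<le> (\<Sum>c<t. (s c j)\<^sup>2)" by simp
    then show ?thesis
      using pos0[OF j] by (simp add: s_def power_mult_distrib sum_distrib_left)
  qed
  have w_sum: "(\<Sum>j<n. w j) = real t"
  proof -
    have "(\<Sum>j<n. w j) = (\<Sum>j<n. \<Sum>c<t. \<Sum>b<t. K $$ (c, b) * (s b j * s c j))"
      unfolding w_def y_def sum_distrib_right by (simp add: mult.assoc)
    also have "\<dots> = (\<Sum>c<t. \<Sum>j<n. \<Sum>b<t. K $$ (c, b) * (s b j * s c j))"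
      by (rule sum.swap)
    also have "\<dots> = (\<Sum>c<t. \<Sum>b<t. \<Sum>j<n. K $$ (c, b) * (s b j * s c j))"
      by (intro sum.cong refl sum.swap)
    also have "\<dots> = (\<Sum>c<t. \<Sum>b<t. K $$ (c, b) * (\<Sum>j<n. s b j * s c j))"
      by (simp add: sum_distrib_left)
    also have "\<dots> = (\<Sum>c<t. (K * T) $$ (c, c))"
      by (intro sum.cong refl) (simp add: mult_mat_index[OF K(1) gram_carrier] T_def del: index_mult_mat)
    finally show ?thesis by (simp add: K(3))
  qed
  have w_zero: "w j = 0" if "j < n" "es ! j = 0" for j
    using w_le[OF that(1)] w0[of j] that(2) by simp
  have tn: "t \<le> n"
    by (rule weighted_inverse_sum_bound(1)[where es = es and n = n and w = w and t = t]) (simp_all add: sorted nonneg len w0 w1 w_zero w_sum)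
  have pos: "0 < es ! j" if "j < t" for j
    by (rule weighted_inverse_sum_bound(2)[where es = es and n = n and w = w and t = t]) (simp_all add: sorted nonneg len w0 w1 w_zero w_sum that)
  have le: "(\<Sum>j<t. 1 / es ! j) \<le> (\<Sum>j<n. w j / es ! j)"
    by (rule weighted_inverse_sum_bound(3)[where es = es and n = n and w = w and t = t]) (simp_all add: sorted nonneg len w0 w1 w_zero w_sum)
  have sv_k: "singular_value M k = sqrt (es ! (k - 1))" if "k \<in> {1..t}" for k
    using that tn len by (auto simp: singular_value_def sv)
  have "(\<Sum>k = 1..t. inverse ((singular_value M k)\<^sup>2)) = (\<Sum>k = 1..t. 1 / es ! (k - 1))"
    using pos by (intro sum.cong refl) (auto simp: sv_k inverse_eq_divide less_imp_le)
  also have "\<dots> = (\<Sum>j<t. 1 / es ! j)"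
    by (rule sum.reindex_bij_witness[of _ Suc "\<lambda>k. k - 1"]) auto
  also have "\<dots> \<le> (\<Sum>j<n. w j / es ! j)" by (rule le)
  also have "\<dots> \<le> (\<Sum>j<n. \<Sum>c<t. (S $$ (j, c))\<^sup>2)"
  proof (rule sum_mono)
    fix j assume "j \<in> {..<n}"
    then have j: "j < n" by simp
    show "w j / es ! j \<le> (\<Sum>c<t. (S $$ (j, c))\<^sup>2)"
    proof (cases "es ! j = 0")
      case False
      then have "0 < es ! j" using pos0[OF j] by simp
      then show ?thesis using w_le[OF j] by (simp add: pos_divide_le_eq mult.commute)
    qed (simp add: sum_nonneg)
  qed
  also have "\<dots> = (\<Sum>c<t. (transpose_mat S * S) $$ (c, c))"
    by (subst sum.swap, intro sum.cong refl, subst mult_mat_index[OF St S])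
      (use S in \<open>auto simp: power2_eq_square\<close>)
  also have "\<dots> = (\<Sum>c<t. H $$ (c, c))" unfolding SS by (rule trR)
  finally show ?thesis using tn pos by (auto simp: sv_k)
qed

section \<open>Rank and independent rows and columns\<close>

text \<open>X Y is a sum of k products of a column with a row, each of rank at most 1; the induction
  splits off the last one by subadditivity of the rank.\<close>

lemma rank_mult_le_inner_dim:
  fixes X Y :: "real mat"
  assumes "X \<in> carrier_mat m k" "Y \<in> carrier_mat k n"
  shows "vec_space.rank m (X * Y) \<le> k"
  using assms
proof (induction k arbitrary: X Y)
  case 0
  then have "X * Y = 0\<^sub>m m n" by (intro eq_matI) (auto simp: scalar_prod_def)
  then show ?case using vec_space.rank_0I[of m n] by simp
next
  case (Suc k)
  define X' where "X' = mat m k (\<lambda>(i, j). X $$ (i, j))"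
  define Y' where "Y' = mat k n (\<lambda>(i, j). Y $$ (i, j))"
  define Z where "Z = mat m n (\<lambda>(i, j). X $$ (i, k) * Y $$ (k, j))"
  have Z: "Z \<in> carrier_mat m n" and X': "X' \<in> carrier_mat m k" and Y': "Y' \<in> carrier_mat k n"
    by (simp_all add: X'_def Y'_def Z_def)
  have "X * Y = X' * Y' + Z"
    using Suc.prems by (intro eq_matI) (auto simp: X'_def Y'_def Z_def scalar_prod_def)
  moreover have "vec_space.rank m (X' * Y' + Z) \<le> vec_space.rank m (X' * Y') + vec_space.rank m Z"
    by (rule vec_space.rank_subadditive[OF mult_carrier_mat[OF X' Y'] Z])
  moreover have "vec_space.rank m Z \<le> 1"
    by (rule vec_space.rank_le_1_product_entries[OF Z, of "\<lambda>i. X $$ (i, k)" "\<lambda>j. Y $$ (k, j)"])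
      (simp add: Z_def)
  ultimately show ?case using Suc.IH[OF X' Y'] by simp
qed

text \<open>X collects a maximal independent set of columns of M, which spans all columns; Y holds
  the coefficients.\<close>

lemma rank_factorization:
  fixes M :: "real mat"
  assumes M: "M \<in> carrier_mat m n"
  obtains X Y where "X \<in> carrier_mat m (vec_space.rank m M)"
    "Y \<in> carrier_mat (vec_space.rank m M) n" "M = X * Y"
proof -
  interpret vec_space "TYPE(real)" m .
  define P where "P = (\<lambda>T. T \<subseteq> set (cols M) \<and> lin_indpt T)"
  have colsM: "set (cols M) \<subseteq> carrier_vec m" using cols_dim M by blast
  obtain S where max: "maximal S P"
    using maximal_exists[of P "card (set (cols M))" "{}"] unfolding P_def
    by (meson List.finite_set card_mono empty_iff empty_subsetI finite_lin_indpt2 rev_finite_subset)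
  have SM: "S \<subseteq> set (cols M)" and li: "lin_indpt S"
    using max unfolding maximal_def P_def by auto
  then have S: "S \<subseteq> carrier_vec m" "finite S" using colsM finite_subset by auto
  have rk: "rank M = card S" using rank_card_indpt[OF M] max unfolding P_def by blast
  have span: "v \<in> span S" if v: "v \<in> set (cols M)" for v
  proof (rule ccontr)
    assume nv: "v \<notin> span S"
    then have "v \<notin> S" using S span_mem by auto
    then have "lin_indpt (insert v S)"
      using lin_dep_iff_in_span[of S v] S li v colsM nv by auto
    then have "P (insert v S)" using SM v by (simp add: P_def)
    then show False using max \<open>v \<notin> S\<close> unfolding maximal_def by blast
  qed
  obtain us where us: "set us = S" "distinct us" using finite_distinct_list[OF S(2)] by blast
  have len: "length us = rank M" using us rk distinct_card by fastforce
  define X where "X = mat_of_cols m us"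
  have X: "X \<in> carrier_mat m (rank M)" by (simp add: X_def len[symmetric])
  have "\<exists>c. col M j = X *\<^sub>v vec (rank M) c" if "j < n" for j
  proof -
    have "col M j \<in> span S" using span that M by (metis carrier_matD(2) cols_length cols_nth nth_mem)
    then have "col M j \<in> span_list us" using span_list_as_span[of us] S us by simp
    then obtain c where "col M j = lincomb_list c us" unfolding span_list_def by blast
    moreover have "\<forall>w\<in>set us. dim_vec w = m" using S us by auto
    ultimately show ?thesis using lincomb_list_as_mat_mult[of us c] by (auto simp: X_def len)
  qed
  then obtain c where c: "\<And>j. j < n \<Longrightarrow> col M j = X *\<^sub>v vec (rank M) (c j)" by metis
  define Y where "Y = mat (rank M) n (\<lambda>(l, j). c j l)"
  have Y: "Y \<in> carrier_mat (rank M) n" by (simp add: Y_def)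
  have "M = X * Y"
  proof (rule eq_matI)
    fix i j assume "i < dim_row (X * Y)" "j < dim_col (X * Y)"
    then have ij: "i < m" "j < n" using X Y by auto
    have "col Y j = vec (rank M) (c j)" using ij by (auto simp: Y_def)
    then have "(X * Y) $$ (i, j) = (X *\<^sub>v vec (rank M) (c j)) $ i" using X Y ij by simp
    then show "M $$ (i, j) = (X * Y) $$ (i, j)" using c[OF ij(2)] M ij by (metis index_col carrier_matD)
  qed (use M X Y in auto)
  then show ?thesis using that X Y by blast
qed

text \<open>L M B factors through the inner dimension rank M, while an invertible p x p matrix has
  rank p. A nonzero determinant thus certifies a lower bound on the rank.\<close>

lemma nonsingular_compression_rank:
  fixes M :: "real mat"
  assumes M: "M \<in> carrier_mat m n" and L: "L \<in> carrier_mat p m" and B: "B \<in> carrier_mat n p"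
    and det: "det (L * M * B) \<noteq> 0"
  shows "p \<le> vec_space.rank m M"
proof -
  obtain X Y where X: "X \<in> carrier_mat m (vec_space.rank m M)"
    and Y: "Y \<in> carrier_mat (vec_space.rank m M) n" and MXY: "M = X * Y"
    by (rule rank_factorization[OF M])
  have LMB: "L * M * B \<in> carrier_mat p p" using L M B by auto
  have "L * M * B = L * X * Y * B"
    using assoc_mult_mat[OF L X Y] MXY by simp
  also have "\<dots> = (L * X) * (Y * B)"
    by (rule assoc_mult_mat[OF mult_carrier_mat[OF L X] Y B])
  finally have "vec_space.rank p (L * M * B) \<le> vec_space.rank m M"
    using rank_mult_le_inner_dim[OF mult_carrier_mat[OF L X] mult_carrier_mat[OF Y B]] by simp
  then show ?thesis using vec_space.low_rank_det_zero[OF LMB det] by simp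
qed

lemma gram_rows_le_rank:
  fixes M :: "real mat"
  assumes M: "M \<in> carrier_mat m n" and f: "f ` {..<p} \<subseteq> {..<m}" and J: "J \<subseteq> {..<n}"
    and det: "det (gram p (\<lambda>i k. M $$ (f i, k)) J) \<noteq> 0"
  shows "p \<le> vec_space.rank m M"
proof -
  define L where "L = mat p m (\<lambda>(i, j). if j = f i then 1 else 0 :: real)"
  define B where "B = mat n p (\<lambda>(k, i). if k \<in> J then M $$ (f i, k) else 0)"
  have L: "L \<in> carrier_mat p m" and B: "B \<in> carrier_mat n p" by (simp_all add: L_def B_def)
  have LM: "(L * M) $$ (i, k) = M $$ (f i, k)" if "i < p" "k < n" for i k
  proof -
    have "(L * M) $$ (i, k) = (\<Sum>j<m. if j = f i then M $$ (j, k) else 0)"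
      unfolding mult_mat_index[OF L M that] using that by (intro sum.cong) (auto simp: L_def)
    then show ?thesis using f that by auto
  qed
  have "L * M * B = gram p (\<lambda>i k. M $$ (f i, k)) J"
  proof (rule eq_matI)
    fix i j assume "i < dim_row (gram p (\<lambda>i k. M $$ (f i, k)) J)"
      "j < dim_col (gram p (\<lambda>i k. M $$ (f i, k)) J)"
    then have ij: "i < p" "j < p" by auto
    have "(L * M * B) $$ (i, j) = (\<Sum>k<n. if k \<in> J then M $$ (f i, k) * M $$ (f j, k) else 0)"
      unfolding mult_mat_index[OF mult_carrier_mat[OF L M] B ij]
      using ij by (intro sum.cong) (auto simp: LM B_def simp del: index_mult_mat)
    also have "\<dots> = (\<Sum>k\<in>J. M $$ (f i, k) * M $$ (f j, k))"
      using J by (intro sum.mono_neutral_cong_right) auto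
    finally show "(L * M * B) $$ (i, j) = gram p (\<lambda>i k. M $$ (f i, k)) J $$ (i, j)"
      using ij by simp
  qed (use L M B in auto)
  then show ?thesis using nonsingular_compression_rank[OF M L B] det by simp
qed

text \<open>Greedy choice: were every row a combination of the k chosen ones, M would factor through
  dimension k, against k < rank M. A relation with nonzero last coefficient could be solved for the
  new row, so independence persists.\<close>

lemma independent_rows_exist:
  fixes M :: "real mat"
  assumes M: "M \<in> carrier_mat m n" and k: "k \<le> vec_space.rank m M"
  shows "\<exists>f. inj_on f {..<k} \<and> f ` {..<k} \<subseteq> {..<m} \<and>
    det (gram k (\<lambda>i j. M $$ (f i, j)) {..<n}) \<noteq> 0"
  using k
proof (induction k)
  case 0
  show ?case using det_dim_zero[OF gram_carrier[of 0]] by auto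
next
  case (Suc k)
  then obtain f where f: "inj_on f {..<k}" "f ` {..<k} \<subseteq> {..<m}"
    and det: "det (gram k (\<lambda>i j. M $$ (f i, j)) {..<n}) \<noteq> 0" by auto
  have "\<exists>i<m. \<forall>x. \<exists>j<n. M $$ (i, j) \<noteq> (\<Sum>l<k. x l * M $$ (f l, j))"
  proof (rule ccontr)
    assume "\<not> ?thesis"
    then obtain x where x: "\<And>i j. i < m \<Longrightarrow> j < n \<Longrightarrow> M $$ (i, j) = (\<Sum>l<k. x i l * M $$ (f l, j))"
      by metis
    have "M = mat m k (\<lambda>(i, l). x i l) * mat k n (\<lambda>(l, j). M $$ (f l, j))"
      using M x by (intro eq_matI) (auto simp: scalar_prod_def atLeast0LessThan)
    then have "vec_space.rank m M \<le> k"
      by (metis rank_mult_le_inner_dim mat_carrier)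
    then show False using Suc.prems by simp
  qed
  then obtain i where i: "i < m" and ni: "\<And>x. \<exists>j<n. M $$ (i, j) \<noteq> (\<Sum>l<k. x l * M $$ (f l, j))"
    by blast
  define g where "g = f(k := i)"
  have notin: "i \<notin> f ` {..<k}"
  proof
    assume "i \<in> f ` {..<k}"
    then obtain l where l: "l < k" "i = f l" by auto
    have "(\<Sum>l'<k. (if l' = l then 1 else 0) * M $$ (f l', j)) = M $$ (i, j)" for j
      using l by (simp add: if_distrib[of "\<lambda>c. c * _"] cong: if_cong)
    then show False using ni[of "\<lambda>l'. if l' = l then 1 else 0"] by metis
  qed
  have inj: "inj_on g {..<Suc k}"
    using f(1) notin by (auto simp: g_def lessThan_Suc inj_on_def)
  have range: "g ` {..<Suc k} \<subseteq> {..<m}"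
    using f(2) i by (auto simp: g_def lessThan_Suc)
  have "det (gram (Suc k) (\<lambda>i j. M $$ (g i, j)) {..<n}) \<noteq> 0"
  proof
    assume "det (gram (Suc k) (\<lambda>i j. M $$ (g i, j)) {..<n}) = 0"
    then obtain x where nz: "\<exists>l<Suc k. x l \<noteq> 0"
      and x: "\<And>j. j < n \<Longrightarrow> (\<Sum>l<Suc k. x l * M $$ (g l, j)) = 0"
      unfolding gram_det_eq_0_iff[OF finite_lessThan] by auto
    have xs: "(\<Sum>l<k. x l * M $$ (f l, j)) + x k * M $$ (i, j) = 0" if "j < n" for j
      using x[OF that] by (simp add: g_def)
    show False
    proof (cases "x k = 0")
      case True
      then have "\<exists>l<k. x l \<noteq> 0" using nz less_Suc_eq by auto
      moreover have "\<forall>j\<in>{..<n}. (\<Sum>l<k. x l * M $$ (f l, j)) = 0" using xs True by auto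
      ultimately show False using det unfolding gram_det_eq_0_iff[OF finite_lessThan] by blast
    next
      case False
      obtain j where j: "j < n" "M $$ (i, j) \<noteq> (\<Sum>l<k. - x l / x k * M $$ (f l, j))"
        using ni[of "\<lambda>l. - x l / x k"] by blast
      have "(\<Sum>l<k. - x l / x k * M $$ (f l, j)) = - (\<Sum>l<k. x l * M $$ (f l, j)) / x k"
        by (simp add: sum_divide_distrib sum_negf)
      also have "\<dots> = M $$ (i, j)" using xs[OF j(1)] False by (simp add: field_simps)
      finally show False using j(2) by simp
    qed
  qed
  then show ?case using inj range by blast
qed

text \<open>While \<open>J\<close> has more than q >= p columns, the sum of the determinants over
  single deletions is a nonzero multiple of the current one, so some deletion keeps the determinant
  nonzero.\<close>

lemma independent_columns_exist:
  assumes "finite J" "p \<le> q" "q \<le> card J" "det (gram p a J) \<noteq> 0"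
  shows "\<exists>J'\<subseteq>J. card J' = q \<and> det (gram p a J') \<noteq> 0"
  using assms
proof (induction "card J" arbitrary: J rule: less_induct)
  case less
  show ?case
  proof (cases "card J = q")
    case False
    then have "(real (card J) - real p) * det (gram p a J) \<noteq> 0" using less.prems by simp
    then have "(\<Sum>j\<in>J. det (gram p a (J - {j}))) \<noteq> 0"
      using sum_gram_remove_col[OF less.prems(1)] by metis
    then obtain j where j: "j \<in> J" "det (gram p a (J - {j})) \<noteq> 0"
      by (meson sum.neutral)
    have "card (J - {j}) = card J - 1" using j less.prems by simp
    then have "card (J - {j}) < card J" "q \<le> card (J - {j})"
      using j less.prems False by (auto simp: card_gt_0_iff)
    then obtain J' where "J' \<subseteq> J - {j}" "card J' = q" "det (gram p a J') \<noteq> 0"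
      using less.hyps[of "J - {j}"] less.prems j by auto
    then show ?thesis by blast
  qed (use less.prems in auto)
qed

text \<open>Maximality is stated over permutations, while the argument compares arbitrary row
  choices and column sets. The two complements have equal size, and any bijection between them
  completes f.\<close>

lemma injection_extends_to_permutation:
  assumes inj: "inj_on f {..<p}" and range: "f ` {..<p} \<subseteq> {..<m :: nat}"
  obtains \<pi> where "\<pi> permutes {..<m}" "\<And>i. i < p \<Longrightarrow> \<pi> i = f i"
proof -
  have cf: "card (f ` {..<p}) = p" using inj by (simp add: card_image)
  then have pm: "p \<le> m" using card_mono[OF finite_lessThan range] by simp
  have "card ({..<m} - {..<p}) = card ({..<m} - f ` {..<p})"
    using pm range cf by (simp add: card_Diff_subset)
  then obtain h where h: "bij_betw h ({..<m} - {..<p}) ({..<m} - f ` {..<p})"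
    using finite_same_card_bij[of "{..<m} - {..<p}" "{..<m} - f ` {..<p}"] by auto
  define \<pi> where "\<pi> i = (if i < p then f i else if i < m then h i else i)" for i
  have "bij_betw \<pi> {..<p} (f ` {..<p})"
    using inj by (simp add: \<pi>_def bij_betw_def inj_on_def)
  moreover have "bij_betw \<pi> ({..<m} - {..<p}) ({..<m} - f ` {..<p})"
    using h by (rule bij_betw_cong[THEN iffD1, rotated]) (auto simp: \<pi>_def)
  ultimately have "bij_betw \<pi> ({..<p} \<union> ({..<m} - {..<p})) (f ` {..<p} \<union> ({..<m} - f ` {..<p}))"
    by (rule bij_betw_combine) auto
  moreover have "{..<p} \<union> ({..<m} - {..<p}) = {..<m}" "f ` {..<p} \<union> ({..<m} - f ` {..<p}) = {..<m}"
    using pm range by auto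
  ultimately have "bij_betw \<pi> {..<m} {..<m}" by simp
  then have "\<pi> permutes {..<m}"
    by (rule bij_imp_permutes) (use pm in \<open>auto simp: \<pi>_def\<close>)
  then show ?thesis using that by (auto simp: \<pi>_def)
qed

section \<open>Permutations and the pseudo skeleton\<close>

definition perm_mat :: "nat \<Rightarrow> (nat \<Rightarrow> nat) \<Rightarrow> real mat" where
  "perm_mat n \<pi> = mat n n (\<lambda>(i, j). if j = \<pi> i then 1 else 0)"

lemma perm_mat_carrier [simp]: "perm_mat n \<pi> \<in> carrier_mat n n"
  by (simp add: perm_mat_def)

lemma permutation_mat_iff:
  "permutation_mat n P \<longleftrightarrow> (\<exists>\<pi>. \<pi> permutes {..<n} \<and> P = perm_mat n \<pi>)"
  by (simp add: permutation_mat_def perm_mat_def)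

lemma perm_mat_mult_index:
  assumes A: "A \<in> carrier_mat m n" and \<pi>: "\<pi> permutes {..<m}" and ij: "i < m" "j < n"
  shows "(perm_mat m \<pi> * A) $$ (i, j) = A $$ (\<pi> i, j)"
proof -
  have "(perm_mat m \<pi> * A) $$ (i, j) = (\<Sum>k<m. if k = \<pi> i then A $$ (k, j) else 0)"
    unfolding mult_mat_index[OF perm_mat_carrier A ij]
    using ij by (intro sum.cong) (auto simp: perm_mat_def)
  moreover have "\<pi> i < m" using permutes_in_image[OF \<pi>, of i] ij by simp
  ultimately show ?thesis by simp
qed

lemma transpose_perm_mat_mult_index:
  assumes A: "A \<in> carrier_mat m n" and \<pi>: "\<pi> permutes {..<m}" and ij: "i < m" "j < n"
  shows "(transpose_mat (perm_mat m \<pi>) * A) $$ (\<pi> i, j) = A $$ (i, j)"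
proof -
  have \<pi>i: "\<pi> i < m" using permutes_in_image[OF \<pi>, of i] ij by simp
  have Pt: "transpose_mat (perm_mat m \<pi>) \<in> carrier_mat m m" by simp
  have "(transpose_mat (perm_mat m \<pi>) * A) $$ (\<pi> i, j) = (\<Sum>k<m. if k = i then A $$ (k, j) else 0)"
    unfolding mult_mat_index[OF Pt A \<pi>i ij(2)]
    using ij \<pi>i permutes_inj[OF \<pi>] by (intro sum.cong) (auto simp: perm_mat_def inj_eq)
  then show ?thesis using ij by simp
qed

lemma mult_index_transpose:
  fixes A B :: "real mat"
  assumes A: "A \<in> carrier_mat m n" and B: "B \<in> carrier_mat n l" and ij: "i < m" "j < l"
  shows "(A * B) $$ (i, j) = (transpose_mat B * transpose_mat A) $$ (j, i)"
  using transpose_mult[OF A B] A B ij by (metis index_transpose_mat(1) index_mult_mat(2,3) carrier_matD)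

lemma permuted_index:
  assumes M: "M \<in> carrier_mat m n" and \<pi>: "\<pi> permutes {..<m}" "\<rho> permutes {..<n}"
    and ij: "i < m" "j < n"
  shows "(perm_mat m \<pi> * M * transpose_mat (perm_mat n \<rho>)) $$ (i, j) = M $$ (\<pi> i, \<rho> j)"
proof -
  have PM: "perm_mat m \<pi> * M \<in> carrier_mat m n" using M by (rule mult_carrier_mat[OF perm_mat_carrier])
  have Pt: "transpose_mat (perm_mat n \<rho>) \<in> carrier_mat n n" by simp
  have \<rho>j: "\<rho> j < n" using permutes_in_image[OF \<pi>(2), of j] ij by simp
  have "(perm_mat m \<pi> * M * transpose_mat (perm_mat n \<rho>)) $$ (i, j)
      = (perm_mat n \<rho> * transpose_mat (perm_mat m \<pi> * M)) $$ (j, i)"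
    using mult_index_transpose[OF PM Pt ij] by simp
  also have "\<dots> = transpose_mat (perm_mat m \<pi> * M) $$ (\<rho> j, i)"
    by (rule perm_mat_mult_index[OF _ \<pi>(2) ij(2,1)]) (use PM in simp)
  also have "\<dots> = M $$ (\<pi> i, \<rho> j)"
    using PM \<rho>j ij perm_mat_mult_index[OF M \<pi>(1) ij(1) \<rho>j] by (metis carrier_matD index_transpose_mat(1))
  finally show ?thesis .
qed

lemma unpermuted_index:
  assumes Z: "Z \<in> carrier_mat m n" and \<pi>: "\<pi> permutes {..<m}" "\<rho> permutes {..<n}"
    and ij: "i < m" "j < n"
  shows "(transpose_mat (perm_mat m \<pi>) * Z * perm_mat n \<rho>) $$ (\<pi> i, \<rho> j) = Z $$ (i, j)"
proof -
  have Pt: "transpose_mat (perm_mat m \<pi>) \<in> carrier_mat m m" by simp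
  have PZ: "transpose_mat (perm_mat m \<pi>) * Z \<in> carrier_mat m n"
    using Z by (rule mult_carrier_mat[OF Pt])
  have lt: "\<pi> i < m" "\<rho> j < n"
    using permutes_in_image[OF \<pi>(1), of i] permutes_in_image[OF \<pi>(2), of j] ij by simp_all
  have "(transpose_mat (perm_mat m \<pi>) * Z * perm_mat n \<rho>) $$ (\<pi> i, \<rho> j)
      = (transpose_mat (perm_mat n \<rho>) * transpose_mat (transpose_mat (perm_mat m \<pi>) * Z)) $$ (\<rho> j, \<pi> i)"
    by (rule mult_index_transpose[OF PZ perm_mat_carrier lt])
  also have "\<dots> = transpose_mat (transpose_mat (perm_mat m \<pi>) * Z) $$ (j, \<pi> i)"
    by (rule transpose_perm_mat_mult_index[OF _ \<pi>(2) ij(2) lt(1)]) (use PZ in simp)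
  also have "\<dots> = Z $$ (i, j)"
    using PZ lt ij transpose_perm_mat_mult_index[OF Z \<pi>(1) ij] by (metis carrier_matD index_transpose_mat(1))
  finally show ?thesis .
qed

lemma leading_block_eq:
  assumes M: "M \<in> carrier_mat m n" and \<pi>: "\<pi> permutes {..<m}" "\<rho> permutes {..<n}"
    and pq: "p \<le> m" "q \<le> n"
  shows "leading_block M p q (perm_mat m \<pi>) (perm_mat n \<rho>) = mat p q (\<lambda>(i, j). M $$ (\<pi> i, \<rho> j))"
  unfolding leading_block_def perm_blocks_def split_block_def Let_def
  using pq by (auto intro!: cong_mat simp: permuted_index[OF M \<pi>] simp del: index_mult_mat)

text \<open>With X = A^T H one has A X = 1, which settles every Penrose equation except the symmetry
  of X A = A^T H A. That one uses that H is symmetric, being the inverse of the symmetric A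
  A^T.\<close>

lemma pinv_full_row_rank:
  assumes A: "A \<in> carrier_mat p q" and H: "H \<in> carrier_mat p p"
    and GH: "A * transpose_mat A * H = 1\<^sub>m p" and HG: "H * (A * transpose_mat A) = 1\<^sub>m p"
  shows "pinv A = transpose_mat A * H"
proof -
  define G where "G = A * transpose_mat A"
  have G: "G \<in> carrier_mat p p" and At: "transpose_mat A \<in> carrier_mat q p" using A by (auto simp: G_def)
  note GH' = GH[folded G_def] and HG' = HG[folded G_def]
  have Gt: "transpose_mat G = G" unfolding G_def using transpose_mult[OF A At] by simp
  have Ht: "transpose_mat H = H"
  proof -
    have "transpose_mat H * G = 1\<^sub>m p" using transpose_mult[OF G H] GH' Gt by simp
    then have "transpose_mat H * G * H = H" using H by simp
    moreover have "transpose_mat H * G * H = transpose_mat H"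
      using assoc_mult_mat[OF _ G H, of "transpose_mat H" p] H GH' by simp
    ultimately show ?thesis by simp
  qed
  define X where "X = transpose_mat A * H"
  have X: "X \<in> carrier_mat q p" using At H by (simp add: X_def)
  have AX: "A * X = 1\<^sub>m p"
    unfolding X_def using assoc_mult_mat[OF A At H] GH by simp
  have "transpose_mat (X * A) = transpose_mat A * transpose_mat X"
    by (rule transpose_mult[OF X A])
  also have "transpose_mat X = H * A"
    unfolding X_def using transpose_mult[OF At H] Ht by simp
  also have "transpose_mat A * (H * A) = X * A"
    unfolding X_def by (rule assoc_mult_mat[OF At H A, symmetric])
  finally have XA: "transpose_mat (X * A) = X * A" .
  have "X * A * X = X" using assoc_mult_mat[OF X A X] AX X by simp
  then have "is_pinv A X"
    unfolding is_pinv_def using A X AX XA by simp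
  then show ?thesis
    unfolding pinv_def X_def[symmetric] by (intro the_equality is_pinv_unique)
qed

text \<open>Turns optimality among permutation pairs into optimality among all submatrices with p
  rows and q columns, because a Gram determinant sees only the images of the first p row indices and
  the set of the first q column images. Since rank M >= p, some block has rank p, hence so does the
  optimal one.\<close>

lemma max_vol_perms_gram_maximal:
  fixes M :: "real mat"
  assumes M: "M \<in> carrier_mat m n" and pq: "p \<le> q" "p \<le> m" "q \<le> n"
    and rank: "p \<le> mat_rank M"
    and \<pi>: "\<pi> permutes {..<m}" "\<rho> permutes {..<n}"
    and max: "max_vol_perms M p q (perm_mat m \<pi>) (perm_mat n \<rho>)"
  defines "V \<equiv> \<lambda>f J. det (gram p (\<lambda>i k. M $$ (f i, k)) J)"
  shows "V \<pi> (\<rho> ` {..<q}) \<noteq> 0"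
    and "\<And>f J. inj_on f {..<p} \<Longrightarrow> f ` {..<p} \<subseteq> {..<m} \<Longrightarrow> J \<subseteq> {..<n} \<Longrightarrow> card J = q \<Longrightarrow>
      V f J \<le> V \<pi> (\<rho> ` {..<q})"
proof -
  define B where "B \<pi>' \<rho>' = leading_block M p q (perm_mat m \<pi>') (perm_mat n \<rho>')" for \<pi>' \<rho>'
  have B: "B \<pi>' \<rho>' \<in> carrier_mat p q"
    and BB: "B \<pi>' \<rho>' * transpose_mat (B \<pi>' \<rho>') = gram p (\<lambda>i k. M $$ (\<pi>' i, k)) (\<rho>' ` {..<q})"
    if perms: "\<pi>' permutes {..<m}" "\<rho>' permutes {..<n}" for \<pi>' \<rho>'
  proof -
    have eq: "B \<pi>' \<rho>' = mat p q (\<lambda>(i, j). M $$ (\<pi>' i, \<rho>' j))"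
      unfolding B_def by (rule leading_block_eq[OF M perms pq(2,3)])
    then show carr: "B \<pi>' \<rho>' \<in> carrier_mat p q" by simp
    have inj: "inj_on \<rho>' {..<q}" using permutes_inj_on[OF perms(2)] .
    show "B \<pi>' \<rho>' * transpose_mat (B \<pi>' \<rho>') = gram p (\<lambda>i k. M $$ (\<pi>' i, k)) (\<rho>' ` {..<q})"
      unfolding mult_transpose_eq_gram[OF carr] gram_reindex[OF inj]
      by (intro gram_cong) (simp add: eq)
  qed
  have rvolB: "rvol p (B \<pi>' \<rho>') = sqrt (V \<pi>' (\<rho>' ` {..<q}))"
    if perms: "\<pi>' permutes {..<m}" "\<rho>' permutes {..<n}" for \<pi>' \<rho>'
    unfolding rvol_eq_sqrt_det[OF B[OF perms] pq(1)] BB[OF perms] V_def ..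
  have rank_le: "mat_rank (B \<pi>' \<rho>') \<le> p"
    if perms: "\<pi>' permutes {..<m}" "\<rho>' permutes {..<n}" for \<pi>' \<rho>'
    using rank_mult_le_inner_dim[OF one_carrier_mat B[OF perms]] B[OF perms] by simp
  have rank_ge: "p \<le> mat_rank (B \<pi>' \<rho>')"
    if perms: "\<pi>' permutes {..<m}" "\<rho>' permutes {..<n}" and nz: "V \<pi>' (\<rho>' ` {..<q}) \<noteq> 0" for \<pi>' \<rho>'
  proof -
    have "det (gram p (\<lambda>i k. B \<pi>' \<rho>' $$ (id i, k)) {..<q}) \<noteq> 0"
      using nz unfolding V_def BB[OF perms, symmetric] mult_transpose_eq_gram[OF B[OF perms]] by simp
    then have "p \<le> vec_space.rank p (B \<pi>' \<rho>')"
      by (intro gram_rows_le_rank[OF B[OF perms]]) auto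
    then show ?thesis using B[OF perms] by simp
  qed
  have perm_of: "\<exists>\<pi>' \<rho>'. \<pi>' permutes {..<m} \<and> \<rho>' permutes {..<n} \<and> V f J = V \<pi>' (\<rho>' ` {..<q})"
    if f: "inj_on f {..<p}" "f ` {..<p} \<subseteq> {..<m}" and J: "J \<subseteq> {..<n}" "card J = q" for f J
  proof -
    have "finite J" using J finite_subset by blast
    then obtain g where "bij_betw g {0..<q} J"
      using ex_bij_betw_nat_finite[of J] J(2) by blast
    then have g: "inj_on g {..<q}" "g ` {..<q} = J"
      by (auto simp: bij_betw_def atLeast0LessThan)
    obtain \<pi>' where \<pi>': "\<pi>' permutes {..<m}" "\<And>i. i < p \<Longrightarrow> \<pi>' i = f i"
      using injection_extends_to_permutation[OF f] by metis
    have "g ` {..<q} \<subseteq> {..<n}" using g(2) J(1) by simp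
    then obtain \<rho>' where \<rho>': "\<rho>' permutes {..<n}" "\<And>j. j < q \<Longrightarrow> \<rho>' j = g j"
      using injection_extends_to_permutation[OF g(1)] by metis
    have "\<rho>' ` {..<q} = J" unfolding g(2)[symmetric] by (intro image_cong) (auto simp: \<rho>'(2))
    moreover have "V f J = V \<pi>' J"
      unfolding V_def by (intro arg_cong[of _ _ det] gram_cong) (simp add: \<pi>'(2))
    ultimately show ?thesis using \<pi>'(1) \<rho>'(1) by metis
  qed
  have optimal: "mat_rank (B \<pi>' \<rho>') \<le> mat_rank (B \<pi> \<rho>) \<and>
      (mat_rank (B \<pi>' \<rho>') = mat_rank (B \<pi> \<rho>) \<longrightarrow>
        rvol (mat_rank (B \<pi> \<rho>)) (B \<pi>' \<rho>') \<le> rvol (mat_rank (B \<pi> \<rho>)) (B \<pi> \<rho>))"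
    if perms: "\<pi>' permutes {..<m}" "\<rho>' permutes {..<n}" for \<pi>' \<rho>'
    using max perms M unfolding max_vol_perms_def Let_def permutation_mat_iff B_def by auto
  obtain f where f: "inj_on f {..<p}" "f ` {..<p} \<subseteq> {..<m}"
    and Vf: "V f {..<n} \<noteq> 0"
    using independent_rows_exist[OF M, of p] rank M unfolding V_def by auto
  obtain J where J: "J \<subseteq> {..<n}" "card J = q" "V f J \<noteq> 0"
    using independent_columns_exist[of "{..<n}" p q] pq Vf unfolding V_def by auto
  obtain \<pi>1 \<rho>1 where perms1: "\<pi>1 permutes {..<m}" "\<rho>1 permutes {..<n}"
    and V1: "V f J = V \<pi>1 (\<rho>1 ` {..<q})"
    using perm_of[OF f J(1,2)] by blast
  have nz1: "V \<pi>1 (\<rho>1 ` {..<q}) \<noteq> 0" using J(3) V1 by simp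
  have full: "mat_rank (B \<pi> \<rho>) = p"
    using optimal[OF perms1] rank_ge[OF perms1 nz1] rank_le[OF \<pi>] by linarith
  have Vnonneg: "0 \<le> V f' (\<rho>' ` {..<q})" for f' and \<rho>' :: "nat \<Rightarrow> nat"
    unfolding V_def by (intro gram_det_nonneg) simp
  have le: "V \<pi>' (\<rho>' ` {..<q}) \<le> V \<pi> (\<rho> ` {..<q})"
    if perms: "\<pi>' permutes {..<m}" "\<rho>' permutes {..<n}" for \<pi>' \<rho>'
  \<comment> \<open>The volume clause of maximality compares only blocks of equal rank: a competitor
    with V = 0 is trivially no larger, and a nonzero V forces rank p.\<close>
  proof (cases "V \<pi>' (\<rho>' ` {..<q}) = 0")
    case True
    then show ?thesis using Vnonneg[of \<pi> \<rho>] by simp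
  next
    case False
    then have "mat_rank (B \<pi>' \<rho>') = p" using rank_ge[OF perms] rank_le[OF perms] by simp
    then have "rvol p (B \<pi>' \<rho>') \<le> rvol p (B \<pi> \<rho>)" using optimal[OF perms] full by simp
    then show ?thesis unfolding rvolB[OF perms] rvolB[OF \<pi>] by simp
  qed
  show "V \<pi> (\<rho> ` {..<q}) \<noteq> 0"
    using le[OF perms1] nz1 Vnonneg[of \<pi>1 \<rho>1] by linarith
  show "V f' J' \<le> V \<pi> (\<rho> ` {..<q})"
    if "inj_on f' {..<p}" "f' ` {..<p} \<subseteq> {..<m}" "J' \<subseteq> {..<n}" "card J' = q" for f' J'
    using perm_of[OF that] le by metis
qed

text \<open>The coefficients \<open>x i\<close> form row i of L A^T H = L A^+, and the last clause
  is the normal equations of that least squares fit. Indexing by \<open>\<pi> i\<close> and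
  \<open>\<rho> j\<close> undoes the permutations entrywise, so the later argument concerns M
  itself.\<close>

lemma pseudo_skeleton_structure:
  fixes M :: "real mat"
  assumes M: "M \<in> carrier_mat m n" and pq: "p \<le> m" "q \<le> n"
    and \<pi>: "\<pi> permutes {..<m}" "\<rho> permutes {..<n}"
    and nz: "det (gram p (\<lambda>i k. M $$ (\<pi> i, k)) (\<rho> ` {..<q})) \<noteq> 0"
  defines "Mhat \<equiv> pseudo_skeleton M p q (perm_mat m \<pi>) (perm_mat n \<rho>)"
  obtains x where "Mhat \<in> carrier_mat m n" "vec_space.rank m Mhat = p"
    "\<forall>i<m. \<forall>j<n. Mhat $$ (\<pi> i, \<rho> j) = (\<Sum>l<p. x i l * M $$ (\<pi> l, \<rho> j))"
    "\<forall>i<p. \<forall>j<n. Mhat $$ (\<pi> i, \<rho> j) = M $$ (\<pi> i, \<rho> j)"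
    "\<forall>i<m. \<forall>h<p. (\<Sum>k\<in>\<rho> ` {..<q}. M $$ (\<pi> h, k) *
      (M $$ (\<pi> i, k) - (\<Sum>l<p. x i l * M $$ (\<pi> l, k)))) = 0"
proof -
  define N where "N = perm_mat m \<pi> * M * transpose_mat (perm_mat n \<rho>)"
  have N: "N \<in> carrier_mat m n" using M unfolding N_def by (auto simp: perm_mat_def)
  have Nij: "N $$ (i, j) = M $$ (\<pi> i, \<rho> j)" if "i < m" "j < n" for i j
    unfolding N_def by (rule permuted_index[OF M \<pi> that])
  define A where "A = mat p q (\<lambda>(i, j). M $$ (\<pi> i, \<rho> j))"
  define L where "L = mat m q (\<lambda>(i, j). M $$ (\<pi> i, \<rho> j))"
  define R where "R = mat p n (\<lambda>(i, j). M $$ (\<pi> i, \<rho> j))"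
  have A: "A \<in> carrier_mat p q" and At: "transpose_mat A \<in> carrier_mat q p"
    and L: "L \<in> carrier_mat m q" and R: "R \<in> carrier_mat p n"
    by (simp_all add: A_def L_def R_def)
  have inj: "inj_on \<rho> {..<q}" using permutes_inj_on[OF \<pi>(2)] .
  define G where "G = A * transpose_mat A"
  have G: "G \<in> carrier_mat p p" using A by (simp add: G_def)
  have G_gram: "G = gram p (\<lambda>i k. M $$ (\<pi> i, k)) (\<rho> ` {..<q})"
    unfolding G_def mult_transpose_eq_gram[OF A] gram_reindex[OF inj]
    by (intro gram_cong) (simp add: A_def)
  then obtain H where H: "H \<in> carrier_mat p p" "G * H = 1\<^sub>m p" "H * G = 1\<^sub>m p"
    using inverse_matrix_adjugate[OF G] nz by metis
  have pinvA: "pinv A = transpose_mat A * H"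
    by (rule pinv_full_row_rank[OF A H(1)]) (use H(2,3) in \<open>simp_all add: G_def\<close>)
  define X where "X = L * (transpose_mat A * H)"
  have X: "X \<in> carrier_mat m p" unfolding X_def using L At H(1) by auto
  have Mhat: "Mhat = transpose_mat (perm_mat m \<pi>) * (X * R) * perm_mat n \<rho>"
  proof -
    obtain A' B C D where split: "perm_blocks M p q (perm_mat m \<pi>) (perm_mat n \<rho>) = (A', B, C, D)"
      by (metis prod_cases4)
    have blocks: "A' = A" "B = mat p (n - q) (\<lambda>(i, j). N $$ (i, j + q))"
      "C = mat (m - p) q (\<lambda>(i, j). N $$ (i + p, j))"
      using split N pq unfolding perm_blocks_def N_def[symmetric] split_block_def Let_def
      by (auto simp: A_def Nij intro!: eq_matI)
    have "A @\<^sub>r C = L"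
      unfolding append_rows_def blocks using pq
      by (intro eq_matI) (auto simp: A_def L_def Nij)
    moreover have "A @\<^sub>c B = R"
      unfolding append_cols_def blocks using pq
      by (intro eq_matI) (auto simp: A_def R_def Nij)
    ultimately have "Mhat = transpose_mat (perm_mat m \<pi>) * L * (transpose_mat A * H) * R * perm_mat n \<rho>"
      unfolding Mhat_def pseudo_skeleton_def split by (simp add: blocks(1) pinvA)
    also have "transpose_mat (perm_mat m \<pi>) * L * (transpose_mat A * H) = transpose_mat (perm_mat m \<pi>) * X"
      unfolding X_def by (rule assoc_mult_mat[of _ m m _ q _ p]) (use L At H(1) in auto)
    also have "transpose_mat (perm_mat m \<pi>) * X * R = transpose_mat (perm_mat m \<pi>) * (X * R)"
      by (rule assoc_mult_mat[of _ m m _ p _ n]) (use X R in auto)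
    finally show ?thesis .
  qed
  have XR: "X * R \<in> carrier_mat m n" using X R by auto
  have Mhat_carr: "Mhat \<in> carrier_mat m n" unfolding Mhat using XR by (auto simp: perm_mat_def)
  have Mhat_XR: "Mhat $$ (\<pi> i, \<rho> j) = (X * R) $$ (i, j)" if "i < m" "j < n" for i j
    unfolding Mhat by (rule unpermuted_index[OF XR \<pi> that])
  have entry: "Mhat $$ (\<pi> i, \<rho> j) = (\<Sum>l<p. X $$ (i, l) * M $$ (\<pi> l, \<rho> j))" if "i < m" "j < n" for i j
    unfolding Mhat_XR[OF that] mult_mat_index[OF X R that]
    using that by (intro sum.cong) (auto simp: R_def)
  have XG: "X * G = L * transpose_mat A"
  proof -
    have "X * G = L * (transpose_mat A * H * G)"
      unfolding X_def by (rule assoc_mult_mat[OF L mult_carrier_mat[OF At H(1)] G])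
    also have "transpose_mat A * H * G = transpose_mat A"
      using assoc_mult_mat[OF At H(1) G] H(3) At by simp
    finally show ?thesis .
  qed
  have LA: "(L * transpose_mat A) $$ (i, h) = (\<Sum>k<q. M $$ (\<pi> i, \<rho> k) * M $$ (\<pi> h, \<rho> k))"
    if "i < m" "h < p" for i h
    unfolding mult_mat_index[OF L At that] using that
    by (intro sum.cong) (auto simp: L_def A_def)
  have orth: "(\<Sum>k\<in>\<rho> ` {..<q}. M $$ (\<pi> h, k) *
      (M $$ (\<pi> i, k) - (\<Sum>l<p. X $$ (i, l) * M $$ (\<pi> l, k)))) = 0" if ih: "i < m" "h < p" for i h
  proof -
    have "(\<Sum>k\<in>\<rho> ` {..<q}. M $$ (\<pi> h, k) * (\<Sum>l<p. X $$ (i, l) * M $$ (\<pi> l, k)))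
        = (\<Sum>l<p. G $$ (h, l) * X $$ (i, l))"
      unfolding G_gram gram_mult_vec[OF ih(2)] ..
    also have "\<dots> = (X * G) $$ (i, h)"
      unfolding mult_mat_index[OF X G ih] using transpose_gram[of p "\<lambda>i k. M $$ (\<pi> i, k)" "\<rho> ` {..<q}"] ih
      by (intro sum.cong refl) (simp add: G_gram mult.commute)
    also have "\<dots> = (\<Sum>k\<in>\<rho> ` {..<q}. M $$ (\<pi> h, k) * M $$ (\<pi> i, k))"
      unfolding XG LA[OF ih] by (simp add: sum.reindex[OF inj] mult.commute)
    finally show ?thesis by (simp add: right_diff_distrib sum_subtractf)
  qed
  have top: "Mhat $$ (\<pi> i, \<rho> j) = M $$ (\<pi> i, \<rho> j)" if ij: "i < p" "j < n" for i j
  proof -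
    have im: "i < m" using ij pq by simp
    \<comment> \<open>The first p rows of \<open>L\<close> are \<open>A\<close>, so the first p rows
      of \<open>X\<close> are A A^T H = 1.\<close>
    have Xid: "X $$ (i, l) = (if l = i then 1 else 0)" if l: "l < p" for l
    proof -
      have "X = L * transpose_mat A * H" unfolding X_def using assoc_mult_mat[OF L At H(1)] by simp
      then have "X $$ (i, l) = (\<Sum>h<p. (L * transpose_mat A) $$ (i, h) * H $$ (h, l))"
        using mult_mat_index[OF mult_carrier_mat[OF L At] H(1) im l] by simp
      also have "\<dots> = (\<Sum>h<p. G $$ (i, h) * H $$ (h, l))"
        using ij by (intro sum.cong refl)
          (simp add: LA[OF im] G_gram sum.reindex[OF inj] del: index_mult_mat)
      also have "\<dots> = (G * H) $$ (i, l)" using mult_mat_index[OF G H(1) ij(1) l] by simp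
      finally show ?thesis using ij l by (simp add: H(2))
    qed
    have "Mhat $$ (\<pi> i, \<rho> j) = (\<Sum>l<p. if l = i then M $$ (\<pi> i, \<rho> j) else 0)"
      unfolding entry[OF im ij(2)] by (intro sum.cong) (auto simp: Xid)
    then show ?thesis using ij by simp
  qed
  have "vec_space.rank m Mhat \<le> p"
  proof -
    have PX: "transpose_mat (perm_mat m \<pi>) * X \<in> carrier_mat m p"
      and RP: "R * perm_mat n \<rho> \<in> carrier_mat p n"
      using X R by (auto simp: perm_mat_def)
    have Pt: "transpose_mat (perm_mat m \<pi>) \<in> carrier_mat m m" by simp
    have "Mhat = transpose_mat (perm_mat m \<pi>) * X * R * perm_mat n \<rho>"
      unfolding Mhat using assoc_mult_mat[OF Pt X R] by simp
    also have "\<dots> = (transpose_mat (perm_mat m \<pi>) * X) * (R * perm_mat n \<rho>)"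
      by (rule assoc_mult_mat[OF PX R perm_mat_carrier])
    finally show ?thesis using rank_mult_le_inner_dim[OF PX RP] by simp
  qed
  \<comment> \<open>The approximation reproduces the selected p rows of M, so it inherits their
    nonzero Gram determinant.\<close>
  moreover have "p \<le> vec_space.rank m Mhat"
  proof (rule gram_rows_le_rank[OF Mhat_carr])
    show "\<pi> ` {..<p} \<subseteq> {..<m}" using image_mono[of "{..<p}" "{..<m}" \<pi>] permutes_image[OF \<pi>(1)] pq by simp
    show "\<rho> ` {..<q} \<subseteq> {..<n}" using image_mono[of "{..<q}" "{..<n}" \<rho>] permutes_image[OF \<pi>(2)] pq by simp
    have "gram p (\<lambda>i k. Mhat $$ (\<pi> i, k)) (\<rho> ` {..<q}) = gram p (\<lambda>i k. M $$ (\<pi> i, k)) (\<rho> ` {..<q})"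
      using pq by (intro gram_cong) (auto simp: top)
    then show "det (gram p (\<lambda>i k. Mhat $$ (\<pi> i, k)) (\<rho> ` {..<q})) \<noteq> 0" using nz by simp
  qed
  ultimately have rank: "vec_space.rank m Mhat = p" by simp
  show ?thesis
  proof (rule that[of "\<lambda>i l. X $$ (i, l)"])
    show "Mhat \<in> carrier_mat m n" by (rule Mhat_carr)
    show "vec_space.rank m Mhat = p" by (rule rank)
  qed (use entry top orth in blast)+
qed

section \<open>The error bound\<close>

lemma singular_value_nonneg: "0 \<le> singular_value M k"
proof -
  obtain es U where "length es = dim_col M" "sorted (rev es)" and es: "\<forall>e\<in>set es. 0 \<le> e"
    and "char_poly (transpose_mat M * M) = (\<Prod>e\<leftarrow>es. [:- e, 1:])"
    and sv: "singular_values M = map sqrt es"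
    and "U \<in> carrier_mat (dim_col M) (dim_col M)" "transpose_mat U * U = 1\<^sub>m (dim_col M)"
    "transpose_mat U * (transpose_mat M * M) * U = diag_list es"
    by (rule singular_values_spectral[of M "dim_row M" "dim_col M"]) auto
  show ?thesis using es by (auto simp: singular_value_def sv)
qed

text \<open>Settles the degenerate cases, in which the error is 0; p <= q keeps the denominator
  positive.\<close>

lemma skeleton_bound_nonneg:
  assumes "p \<le> q"
  shows "0 \<le> sqrt (zeta_gram p M / (1 - real p / (real q + 1))) * singular_value M (p + 1)"
proof -
  have "0 \<le> zeta_gram p M / (1 - real p / (real q + 1))"
    using assms unfolding zeta_gram_def harmonic_mean_def
    by (intro divide_nonneg_nonneg sum_nonneg) auto
  then show ?thesis by (simp add: singular_value_nonneg)
qed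

text \<open>f lists the rows of the maximal block and, at index p, the row of the error entry. Rows
  and columns are named by their position in M, so the trace bound applies directly to the bordered
  block.\<close>

lemma maximal_volume_residual_bound:
  fixes M :: "real mat"
  assumes M: "M \<in> carrier_mat m n" and pq: "p \<le> q"
    and f: "inj_on f {..p}" "f ` {..p} \<subseteq> {..<m}"
    and J: "J \<subseteq> {..<n}" "card J = q" and c: "c < n"
  defines "V \<equiv> \<lambda>f J. det (gram p (\<lambda>i k. M $$ (f i, k)) J)"
  assumes nz: "V f J \<noteq> 0"
    and max: "\<And>h K. inj_on h {..<p} \<Longrightarrow> h ` {..<p} \<subseteq> {..<m} \<Longrightarrow> K \<subseteq> {..<n} \<Longrightarrow> card K = q \<Longrightarrow>
      V h K \<le> V f J"
    and r: "\<And>k. r k = M $$ (f p, k) - (\<Sum>l<p. x l * M $$ (f l, k))"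
    and orth: "\<And>i. i < p \<Longrightarrow> (\<Sum>k\<in>J. M $$ (f i, k) * r k) = 0"
  shows "\<bar>r c\<bar> \<le> sqrt (zeta_gram p M / (1 - real p / (real q + 1))) * singular_value M (p + 1)"
proof -
  define a where "a = (\<lambda>i k. M $$ (f i, k))"
  have finJ: "finite J" using J finite_subset by blast
  have V0: "0 < V f J" using nz gram_det_nonneg[OF finJ, of p a] unfolding V_def a_def by simp
  define K where "K = insert c J"
  have K: "K \<subseteq> {..<n}" "finite K" using J c finJ by (auto simp: K_def)
  define G where "G = gram (Suc p) a K"
  have G: "G \<in> carrier_mat (Suc p) (Suc p)" by (simp add: G_def)
  have resid: "V f J * (r c)\<^sup>2 \<le> det G"
    unfolding V_def G_def K_def a_def
    by (rule gram_residual_bound[OF finJ, where x = x])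
      (use nz r orth in \<open>auto simp: V_def\<close>)
  have den: "0 < real q + 1 - real p" using pq by simp
  show ?thesis
  proof (cases "det G = 0")
    case True
    then have "r c = 0" using resid V0 by (simp add: mult_le_0_iff)
    then show ?thesis using skeleton_bound_nonneg[OF pq] by simp
  next
    case False
    have detG: "0 < det G" using False gram_det_nonneg[OF K(2), of "Suc p" a] by (simp add: G_def)
    obtain H where H: "H \<in> carrier_mat (Suc p) (Suc p)" "G * H = 1\<^sub>m (Suc p)"
      and Hii: "\<forall>i<Suc p. H $$ (i, i) = det (mat_delete G i i) / det G"
      using inverse_matrix_adjugate[OF G False] by metis
    \<comment> \<open>This is p+1 divided by the harmonic mean in \<open>zeta_gram\<close>.\<close>
    define S where "S = (\<Sum>k = 1..p + 1. inverse ((singular_value M k)\<^sup>2))"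
    have f': "inj_on f {..<Suc p}" "f ` {..<Suc p} \<subseteq> {..<m}"
      using f by (simp_all add: lessThan_Suc_atMost)
    have tr: "\<forall>k\<in>{1..Suc p}. 0 < singular_value M k" "S \<le> (\<Sum>i<Suc p. H $$ (i, i))"
      using trace_inverse_gram_bound[OF M f' K(1) H(1)] H(2) unfolding G_def a_def S_def by auto
    have \<sigma>: "0 < singular_value M (p + 1)" using tr(1) by simp
    have "0 < inverse ((singular_value M k)\<^sup>2)" if "k \<in> {1..p + 1}" for k
    proof -
      have "0 < singular_value M k" using tr(1) that by simp
      then show ?thesis by simp
    qed
    then have S0: "0 < S" unfolding S_def by (intro sum_pos) auto
    \<comment> \<open>For c in \<open>J\<close> the bordered block has only q columns, so the minor
      is itself a competing volume and the factor (q+1)/(q+1-p) >= 1 is slack. For c outside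
      \<open>J\<close>, the minor times q+1-p is a sum of q+1 competing volumes, one per deleted
      column.\<close>
    have minor: "det (mat_delete G i i) * (real q + 1 - real p) \<le> (real q + 1) * V f J" if i: "i < Suc p" for i
    proof -
      define h where "h = (\<lambda>l. f (insert_index i l))"
      have ins: "insert_index i ` {..<p} \<subseteq> {..p}" by (auto simp: insert_index_def)
      have h: "inj_on h {..<p}" "h ` {..<p} \<subseteq> {..<m}"
        using comp_inj_on[OF insert_index_inj_on[of i "{..<p}"] inj_on_subset[OF f(1) ins]] f(2) ins
        by (auto simp: h_def o_def)
      have minor_V: "det (mat_delete G i i) = V h K"
        unfolding G_def mat_delete_gram[OF i] by (simp add: V_def h_def a_def)
      show ?thesis
      proof (cases "c \<in> J")
        case True
        then have "K = J" by (auto simp: K_def)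
        then have "V h K \<le> V f J" using max[OF h J] by simp
        then have "V h K * (real q + 1 - real p) \<le> V f J * (real q + 1)"
          using V0 den by (intro mult_mono) auto
        then show ?thesis by (simp add: minor_V mult.commute)
      next
        case False
        then have cardK: "card K = q + 1" using finJ J by (simp add: K_def)
        have "(\<Sum>j\<in>K. V h (K - {j})) \<le> (\<Sum>j\<in>K. V f J)"
          using K cardK by (intro sum_mono max[OF h]) auto
        then show ?thesis
          unfolding minor_V V_def sum_gram_remove_col[OF K(2)] using cardK by (simp add: mult.commute add.commute)
      qed
    qed
    have "V f J * (r c)\<^sup>2 * S * (real q + 1 - real p)
        \<le> det G * (\<Sum>i<Suc p. H $$ (i, i)) * (real q + 1 - real p)"
      using resid tr(2) S0 detG den by (intro mult_right_mono mult_mono) auto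
    also have "\<dots> = (\<Sum>i<Suc p. det (mat_delete G i i) * (real q + 1 - real p))"
      using detG Hii by (simp add: sum_distrib_left sum_distrib_right algebra_simps del: sum.lessThan_Suc)
    also have "\<dots> \<le> (\<Sum>i<Suc p. (real q + 1) * V f J)"
      using minor by (intro sum_mono) auto
    also have "\<dots> = V f J * ((real p + 1) * (real q + 1))" by simp
    finally have "V f J * ((r c)\<^sup>2 * (S * (real q + 1 - real p))) \<le> V f J * ((real p + 1) * (real q + 1))"
      by (simp only: mult.assoc)
    then have "(r c)\<^sup>2 * (S * (real q + 1 - real p)) \<le> (real p + 1) * (real q + 1)"
      using V0 by simp
    then have "(r c)\<^sup>2 \<le> (real p + 1) * (real q + 1) / (S * (real q + 1 - real p))"
      using S0 den by (simp add: pos_le_divide_eq)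
    then have "\<bar>r c\<bar> \<le> sqrt ((real p + 1) * (real q + 1) / (S * (real q + 1 - real p)))"
      using real_le_rsqrt by (metis power2_abs)
    also have "\<dots> = sqrt (zeta_gram p M / (1 - real p / (real q + 1)) * (singular_value M (p + 1))\<^sup>2)"
    proof -
      have z: "zeta_gram p M = (real p + 1) / S / (singular_value M (p + 1))\<^sup>2"
        by (simp add: zeta_gram_def harmonic_mean_def S_def add.commute)
      have d: "1 - real p / (real q + 1) = (real q + 1 - real p) / (real q + 1)"
        by (simp add: field_simps)
      \<comment> \<open>\<open>zeta_gram\<close> divides by the squared singular value that the
        bound multiplies back, so it cancels once it is nonzero.\<close>
      have alg: "a * b / (t * e) = a / t / s / (e / b) * s" if "s \<noteq> 0" for a b t e s :: real
        using that by simp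
      show ?thesis unfolding z d by (rule arg_cong[of _ _ sqrt], rule alg) (use \<sigma> in simp)
    qed
    also have "\<dots> = sqrt (zeta_gram p M / (1 - real p / (real q + 1))) * singular_value M (p + 1)"
      unfolding real_sqrt_mult using \<sigma> by simp
    finally show ?thesis .
  qed
qed

theorem theorem4:
  fixes M Mhat :: "real mat" and m n p q r :: nat
  assumes "M \<in> carrier_mat m n"
    and "0 < p" and "p \<le> q" and "p \<le> m" and "q \<le> n"
    and "mat_rank M \<ge> p + 1"
    and "max_vol_pseudo_skeleton M p q Mhat"
    and "r = mat_rank Mhat"
  shows "chebyshev_norm (Mhat - M)
    \<le> sqrt (zeta_gram r M / (1 - real r / (real q + 1))) * singular_value M (r + 1)"
proof -
  note M = assms(1)
  obtain P1 P2 where max: "max_vol_perms M p q P1 P2" and Mhat: "Mhat = pseudo_skeleton M p q P1 P2"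
    using assms(7) unfolding max_vol_pseudo_skeleton_def by blast
  have "permutation_mat m P1" "permutation_mat n P2"
    using max M unfolding max_vol_perms_def by auto
  then obtain \<pi> \<rho> where \<pi>: "\<pi> permutes {..<m}" "\<rho> permutes {..<n}"
    and P: "P1 = perm_mat m \<pi>" "P2 = perm_mat n \<rho>"
    unfolding permutation_mat_iff by blast
  have rank: "p \<le> mat_rank M" using assms(6) by simp
  define J where "J = \<rho> ` {..<q}"
  have inj_\<rho>: "inj_on \<rho> {..<q}" using permutes_inj_on[OF \<pi>(2)] .
  have J: "J \<subseteq> {..<n}" "card J = q"
    using image_mono[of "{..<q}" "{..<n}" \<rho>] permutes_image[OF \<pi>(2)] assms(5) card_image[OF inj_\<rho>]
    by (simp_all add: J_def)
  note vol = max_vol_perms_gram_maximal[OF M assms(3-5) rank \<pi> max[unfolded P], folded J_def]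
  obtain x where carr: "Mhat \<in> carrier_mat m n" and rk: "vec_space.rank m Mhat = p"
    and entry: "\<forall>i<m. \<forall>j<n. Mhat $$ (\<pi> i, \<rho> j) = (\<Sum>l<p. x i l * M $$ (\<pi> l, \<rho> j))"
    and top: "\<forall>i<p. \<forall>j<n. Mhat $$ (\<pi> i, \<rho> j) = M $$ (\<pi> i, \<rho> j)"
    and orth: "\<forall>i<m. \<forall>h<p. (\<Sum>k\<in>J. M $$ (\<pi> h, k) *
      (M $$ (\<pi> i, k) - (\<Sum>l<p. x i l * M $$ (\<pi> l, k)))) = 0"
    by (rule pseudo_skeleton_structure[OF M assms(4,5) \<pi> vol(1)[unfolded J_def],
        folded Mhat[unfolded P] J_def])
  \<comment> \<open>The rank in the statement is that of the approximation; a maximal block attains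
    p, so every constant may be taken at p.\<close>
  have r: "r = p" using assms(8) carr rk by simp
  define b where "b = sqrt (zeta_gram p M / (1 - real p / (real q + 1))) * singular_value M (p + 1)"
  have bound: "\<bar>(Mhat - M) $$ (i, j)\<bar> \<le> b" if ij: "i < m" "j < n" for i j
  proof -
    obtain i' where i': "i = \<pi> i'" "i' < m" using permutes_image[OF \<pi>(1)] ij(1) by blast
    obtain j' where j': "j = \<rho> j'" "j' < n" using permutes_image[OF \<pi>(2)] ij(2) by blast
    have diff: "(Mhat - M) $$ (i, j) = Mhat $$ (i, j) - M $$ (i, j)" using M carr ij by simp
    show ?thesis
    proof (cases "i' < p")
      case True
      then have "(Mhat - M) $$ (i, j) = 0"
        unfolding diff using top j'(2) by (simp add: i'(1) j'(1))
      then show ?thesis using skeleton_bound_nonneg[OF assms(3), of M] by (simp add: b_def)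
    next
      case False
      \<comment> \<open>Index p is redirected to the row of the error entry; as i' is not below p,
        the map stays injective on the p+1 indices.\<close>
      define f where "f = (\<lambda>l. if l = p then \<pi> i' else \<pi> l)"
      have \<pi>_inj: "\<pi> a = \<pi> c \<longleftrightarrow> a = c" for a c using permutes_inj[OF \<pi>(1)] by (simp add: inj_eq)
      have \<pi>_lt: "\<pi> a < m" if "a < m" for a using permutes_in_image[OF \<pi>(1), of a] that by simp
      have f: "inj_on f {..p}" "f ` {..p} \<subseteq> {..<m}"
        using False i'(2) assms(4) by (auto simp: f_def inj_on_def \<pi>_inj \<pi>_lt)
      have gram_f: "gram p (\<lambda>i k. M $$ (f i, k)) J = gram p (\<lambda>i k. M $$ (\<pi> i, k)) J"
        by (rule gram_cong) (simp add: f_def)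
      define d where "d k = M $$ (\<pi> i', k) - (\<Sum>l<p. x i' l * M $$ (\<pi> l, k))" for k
      have "\<bar>d j\<bar> \<le> b"
        unfolding b_def
      proof (rule maximal_volume_residual_bound[OF M assms(3) f J ij(2), where x = "x i'"])
        show "det (gram p (\<lambda>i k. M $$ (f i, k)) J) \<noteq> 0" unfolding gram_f by (rule vol(1))
        show "det (gram p (\<lambda>i k. M $$ (h i, k)) K) \<le> det (gram p (\<lambda>i k. M $$ (f i, k)) J)"
          if "inj_on h {..<p}" "h ` {..<p} \<subseteq> {..<m}" "K \<subseteq> {..<n}" "card K = q" for h K
          unfolding gram_f by (rule vol(2)[OF that])
        show "d k = M $$ (f p, k) - (\<Sum>l<p. x i' l * M $$ (f l, k))" for k
          by (simp add: d_def f_def)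
        show "(\<Sum>k\<in>J. M $$ (f i, k) * d k) = 0" if "i < p" for i
          using orth i'(2) that by (simp add: d_def f_def)
      qed
      moreover have "(Mhat - M) $$ (i, j) = - d j"
        unfolding diff using entry i'(2) j'(2) by (simp add: d_def i'(1) j'(1))
      ultimately show ?thesis by simp
    qed
  qed
  have "chebyshev_norm (Mhat - M) \<le> b"
    unfolding chebyshev_norm_def
  proof (rule Max.boundedI)
    show "finite {\<bar>(Mhat - M) $$ (i, j)\<bar> |i j. i < dim_row (Mhat - M) \<and> j < dim_col (Mhat - M)}"
      by (rule finite_image_set2) auto
    have "0 < m" "0 < n" using assms by auto
    then show "{\<bar>(Mhat - M) $$ (i, j)\<bar> |i j. i < dim_row (Mhat - M) \<and> j < dim_col (Mhat - M)} \<noteq> {}"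
      using M carr by auto
  qed (use bound M in auto)
  then show ?thesis by (simp add: b_def r)
qed

end
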